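(* Assume $\log n\ll b<a$ and consider $\mathcal{S}_k^\nu$ with any $\nu\ge1$. Let $\alpha\in(\frac12,1)$, $s=s_n=n^{1-\alpha}$, and consider the signal strength $$A=\sqrt{\frac{C\log n}{\sigma_{n0}^2}},\qquad \sigma_{n0}^2=\frac nk\cdot\frac an\Big(1-\frac an\Big)+\frac{(k-1)n}{k}\cdot\frac bn\Big(1-\frac bn\Big).$$ Then all tests are asymptotically powerless against $\Xi(s_n,A_n)$ if $C<C_{\mathrm{sparse}}(\alpha)$, where $$C_{\mathrm{sparse}}(\alpha)=\begin{cases}2\left(\dfrac{\frac1k\tau_a(1-\tau_a)+\frac{k-1}{k}\tau_b(1-\tau_b)}{\frac1k\frac{\tau_a}{1-\tau_a}+\frac{k-1}k\frac{\tau_b}{1-\tau_b}}\right)\left(\alpha-\frac12\right) & \text{for } \frac12<\alpha<\frac34,\\[3mm] 2\left(\dfrac{\frac1k\tau_a(1-\tau_a)+\frac{k-1}{k}\tau_b(1-\tau_b)}{\frac1k\frac{\tau_a}{1-\tau_a}+\frac{k-1}k\frac{\tau_b}{1-\tau_b}}\right)\left(1-\sqrt{1-\alpha}\right)^2 & \text{for }\alpha\ge\frac34.\end{cases}$$ When $\tau_a=\tau_b=0$, the constant is obtained by taking the limit $\tau_a,\tau_b\to0$, i.e. $C_{\mathrm{sparse}}(\alpha)=2(\alpha-\frac12)$ for $\frac12<\alpha<\frac34$ and $C_{\mathrm{sparse}}(\alpha)=2(1-\sqrt{1-\alpha})^2$ for $\alpha\ge\frac34$.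
   Context: **Model.** $k$ is a fixed number of communities. A community assignment is a partition $\mathcal{C}=\{\tilde S_1,\dots,\tilde S_k\}$ of $[n]=\{1,\dots,n\}$. For $\nu\ge1$, $\mathcal{S}_k^{\nu}$ is the set of all such partitions with $|\tilde S_l|\in[n/(k\nu),\,n\nu/k]$ for all $l$. For $\mathbf\Theta=(\theta_1,\dots,\theta_n)\in\mathbb{R}_+^n$ and sequences $a=a_n,b=b_n$, $\mathbb{P}^{(\mathcal C)}_{\mathbf\Theta,a,b}$ is the law of the simple random graph on $[n]$ with adjacency matrix $\mathbf Y=(Y_{ij})$ (symmetric, zero diagonal) whose edges are independent with $\mathbb{P}(Y_{ij}=1)=\min(\theta_i\theta_j\frac an,1)$ if $i,j$ lie in the same block of $\mathcal C$ and $\min(\theta_i\theta_j\frac bn,1)$ otherwise. **Standing assumptions.** $0<b<a\le n/2$; $0<\liminf \frac ba\le\limsup\frac ba<1$; the limits $\tau_a=\lim a/n$, $\tau_b=\lim b/n$ exist; $a,b$ are known. $x_n\ll y_n$ means $x_n/y_n\to0$. **Testing problem.** $\Xi(s,A)=\{\mathbf\Theta\in\mathbb{R}_+^n: |S(\mathbf\Theta)|=s,\ \theta_i\ge 1+A \text{ for } i\in S(\mathbf\Theta)\}$, where $A>0$ and $S(\mathbf\Theta)=\{i:\theta_i\ne1\}$. One tests $H_0:\mathbf\Theta=\mathbf 1$ against $H_1:\mathbf\Theta\in\Xi(s_n,A_n)$. A test $T_n$ is a measurable $\{0,1\}$-valued function of $\mathbf Y$ (value 1 means rejection), with worst-case risk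 $$\mathrm{Risk}_n(T_n,\Xi(s_n,A_n),\mathcal{S}_k^\nu)=\max_{\mathcal C\in\mathcal S_k^\nu}\mathbb{P}^{(\mathcal C)}_{\mathbf 1,a,b}(T_n=1)+\sup_{\mathbf\Theta\in\Xi(s_n,A_n)}\max_{\mathcal C\in\mathcal S_k^\nu}\mathbb{P}^{(\mathcal C)}_{\mathbf\Theta,a,b}(T_n=0).$$ A sequence of tests is asymptotically powerless if $\liminf_n\mathrm{Risk}_n\ge1$. *)

theory Defs
  imports "HOL-Probability.Probability"
begin

definition community_assignments :: "nat \<Rightarrow> real \<Rightarrow> nat \<Rightarrow> nat set set set" where
  "community_assignments k \<nu> n =
     {P. partition_on {1..n} P \<and> card P = k \<and>
         (\<forall>S\<in>P. real n / (real k * \<nu>) \<le> real (card S) \<and> real (card S) \<le> real n * \<nu> / real k)}"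

definition edge_prob ::
  "nat \<Rightarrow> nat set set \<Rightarrow> (nat \<Rightarrow> real) \<Rightarrow> real \<Rightarrow> real \<Rightarrow> nat \<Rightarrow> nat \<Rightarrow> real" where
  "edge_prob n P \<theta> a b i j =
     (if \<exists>S\<in>P. i \<in> S \<and> j \<in> S
      then min (\<theta> i * \<theta> j * (a / real n)) 1
      else min (\<theta> i * \<theta> j * (b / real n)) 1)"

definition vertex_pairs :: "nat \<Rightarrow> (nat \<times> nat) set" where
  "vertex_pairs n = {(i, j). 1 \<le> i \<and> i < j \<and> j \<le> n}"

text \<open>Law of the adjacency matrix. One independent Bernoulli variable is drawn for each pair
  \<open>i < j\<close>; it is copied to \<open>(i, j)\<close> and \<open>(j, i)\<close>. All other entries, in particular the diagonal,
  get the default value of the product and are 0.\<close>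

definition graph_law ::
  "nat \<Rightarrow> nat set set \<Rightarrow> (nat \<Rightarrow> real) \<Rightarrow> real \<Rightarrow> real \<Rightarrow> (nat \<Rightarrow> nat \<Rightarrow> nat) pmf" where
  "graph_law n P \<theta> a b =
     map_pmf (\<lambda>X i j. of_bool (X (min i j, max i j)))
       (Pi_pmf (vertex_pairs n) False (\<lambda>(i, j). bernoulli_pmf (edge_prob n P \<theta> a b i j)))"

text \<open>A vector indexed by \<open>{1..n}\<close> is a function on \<open>nat\<close> whose values outside \<open>{1..n}\<close> are
  irrelevant: neither this set nor the graph law looks at them.\<close>

definition alternatives :: "nat \<Rightarrow> nat \<Rightarrow> real \<Rightarrow> (nat \<Rightarrow> real) set" where
  "alternatives n s A =
     {\<theta>. (\<forall>i\<in>{1..n}. 0 \<le> \<theta> i) \<and> card {i\<in>{1..n}. \<theta> i \<noteq> 1} = s \<and>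
         (\<forall>i\<in>{i\<in>{1..n}. \<theta> i \<noteq> 1}. 1 + A \<le> \<theta> i)}"

text \<open>A test maps the adjacency matrix to a truth value, \<open>True\<close> meaning rejection.
  Measurability is automatic for the discrete law.\<close>

definition risk ::
  "nat \<Rightarrow> ((nat \<Rightarrow> nat \<Rightarrow> nat) \<Rightarrow> bool) \<Rightarrow> real \<Rightarrow> real \<Rightarrow> (nat \<Rightarrow> real) set \<Rightarrow> nat set set set \<Rightarrow> real" where
  "risk n T a b \<Xi> \<S> =
     (MAX P\<in>\<S>. measure_pmf.prob (graph_law n P (\<lambda>_. 1) a b) {Y. T Y}) +
     (SUP \<theta>\<in>\<Xi>. MAX P\<in>\<S>. measure_pmf.prob (graph_law n P \<theta> a b) {Y. \<not> T Y})"

text \<open>The lower limit runs over those \<open>n\<close> for which an admissible community assignment exists,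
  since otherwise the maxima in the risk range over the empty set. For \<open>\<nu> > 1\<close> this holds for all
  large \<open>n\<close>, so the restriction is void; for \<open>\<nu> = 1\<close> it selects the multiples of \<open>k\<close>.\<close>

definition asymptotically_powerless ::
  "nat \<Rightarrow> real \<Rightarrow> (nat \<Rightarrow> real) \<Rightarrow> (nat \<Rightarrow> real) \<Rightarrow> (nat \<Rightarrow> nat) \<Rightarrow> (nat \<Rightarrow> real) \<Rightarrow>
   (nat \<Rightarrow> (nat \<Rightarrow> nat \<Rightarrow> nat) \<Rightarrow> bool) \<Rightarrow> bool" where
  "asymptotically_powerless k \<nu> a b s A T \<longleftrightarrow>
     1 \<le> Liminf (inf sequentially (principal {n. community_assignments k \<nu> n \<noteq> {}}))
           (\<lambda>n. ereal (risk n (T n) (a n) (b n) (alternatives n (s n) (A n))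
                               (community_assignments k \<nu> n)))"

definition sigma_sq :: "nat \<Rightarrow> nat \<Rightarrow> real \<Rightarrow> real \<Rightarrow> real" where
  "sigma_sq k n a b =
     real n / real k * (a / real n) * (1 - a / real n) +
     (real k - 1) * real n / real k * (b / real n) * (1 - b / real n)"

text \<open>The quotient is 0/0 at \<open>\<tau>\<^sub>a = \<tau>\<^sub>b = 0\<close>; there it is assigned its limit, which is 1.\<close>

definition variance_ratio :: "nat \<Rightarrow> real \<Rightarrow> real \<Rightarrow> real" where
  "variance_ratio k \<tau>\<^sub>a \<tau>\<^sub>b =
     (if \<tau>\<^sub>a = 0 \<and> \<tau>\<^sub>b = 0 then 1
      else (1 / real k * \<tau>\<^sub>a * (1 - \<tau>\<^sub>a) + (real k - 1) / real k * \<tau>\<^sub>b * (1 - \<tau>\<^sub>b)) /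
           (1 / real k * (\<tau>\<^sub>a / (1 - \<tau>\<^sub>a)) + (real k - 1) / real k * (\<tau>\<^sub>b / (1 - \<tau>\<^sub>b))))"

definition C_sparse :: "nat \<Rightarrow> real \<Rightarrow> real \<Rightarrow> real \<Rightarrow> real" where
  "C_sparse k \<tau>\<^sub>a \<tau>\<^sub>b \<alpha> =
     (if \<alpha> < 3 / 4 then 2 * variance_ratio k \<tau>\<^sub>a \<tau>\<^sub>b * (\<alpha> - 1 / 2)
      else 2 * variance_ratio k \<tau>\<^sub>a \<tau>\<^sub>b * (1 - sqrt (1 - \<alpha>))\<^sup>2)"

end

theory Submission
  imports Defs "HOL-Real_Asymp.Real_Asymp"
begin

text \<open>Choose one assignment with blocks of nearly equal size and compare the null law with the mixture in
which a uniformly random set \<open>S\<close> of \<open>s\<close> vertices gets the parameter \<open>1 + A\<close>. The risk is at least the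
sum of the two error probabilities in this simple problem (\<open>risk_ge_average\<close>), which tends to at
least 1 as soon as the averaged likelihood ratio is close to 1 in mean.

The likelihood ratio of \<open>S\<close> is a product over edges of factors \<open>1 + d * \<xi>\<close>, where \<open>\<xi>\<close> is the centred and
rescaled edge indicator with second moment \<open>p / (1 - p)\<close>, and \<open>d\<close> is \<open>A\<close> for an edge with one endpoint
in \<open>S\<close>. Hence in the second moment, for two sets \<open>S\<close> and \<open>S'\<close>, every common vertex contributes about
\<open>exp (A\<^sup>2 * I)\<close> with \<open>I\<close> the sum of \<open>p / (1 - p)\<close> over its edges, and everything else is negligible,
because the edges inside \<open>S \<union> S'\<close> number only \<open>O(s\<^sup>2)\<close>. The definition of \<open>A\<close> gives
\<open>A\<^sup>2 * I \<sim> 2 * r * ln n\<close> with \<open>r = C / (2 * variance_ratio)\<close> (\<open>information_ratio_tendsto\<close>). The size of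
\<open>S \<inter> S'\<close> is hypergeometric with mean \<open>s\<^sup>2 / n\<close>, about \<open>n powr (1 - 2 * \<alpha>)\<close>, so the second moment tends to
1 when \<open>r < \<alpha> - 1 / 2\<close> (\<open>sum_power_card_Int_le\<close>).

For larger \<open>r\<close> the second moment explodes, but only because of the rare event that a planted vertex has
an exceptionally large degree score \<open>Z\<close>, the sum of the \<open>\<xi>\<close> over its edges. Therefore the likelihood
ratio is truncated to \<open>A * Z \<le> t * ln n\<close> at all planted vertices
(\<open>truncated_second_moment_bound\<close>). Chernoff bounds handle both the mass that is lost
(\<open>expectation_truncated_ratio_ge\<close>) and the truncated second moment
(\<open>expectation_truncated_ratios_le\<close>): an indicator is dominated by an exponential of the degree score,
so that all expectations still factor over edges and are instances of one estimate,
\<open>expectation_tilted_ratios_le\<close>. In the Gaussian scaling, with \<open>t = 2 * sqrt r\<close>, the first error is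
\<open>n\<close> to the power \<open>(1 - \<alpha>) - (1 - sqrt r)\<^sup>2\<close> and the second is the square of this, so both vanish exactly
when \<open>r < (1 - sqrt (1 - \<alpha>))\<^sup>2\<close> (\<open>truncation_parameters\<close>).\<close>

section \<open>Moments of a single edge\<close>

text \<open>The likelihood ratio of a Bernoulli variable with mean \<open>(1 + d) p\<close> against mean \<open>p\<close> is
\<open>1 + d * score p y\<close>. The score is centred with second moment \<open>p / (1 - p)\<close>, so in every
estimate below only the quadratic coefficient of an edge factor matters.\<close>

definition score :: "real \<Rightarrow> bool \<Rightarrow> real" where
  "score p y = (of_bool y - p) / (1 - p)"

lemma abs_score_le_1:
  assumes "0 < p" "p \<le> 1 / 2"
  shows "\<bar>score p y\<bar> \<le> 1"
  using assms by (cases y) (auto simp: score_def abs_le_iff field_simps)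

lemma expectation_bernoulli_le_exp:
  assumes p: "0 < p" "p \<le> 1 / 2"
    and f: "\<And>y. f y \<le> 1 + l * score p y + q * (score p y)\<^sup>2"
  shows "measure_pmf.expectation (bernoulli_pmf p) f \<le> exp (q * (p / (1 - p)))"
proof -
  have "measure_pmf.expectation (bernoulli_pmf p) f = p * f True + (1 - p) * f False"
    using p by simp
  also have "\<dots> \<le> p * (1 + l * score p True + q * (score p True)\<^sup>2)
      + (1 - p) * (1 + l * score p False + q * (score p False)\<^sup>2)"
    using p f by (intro add_mono mult_left_mono) auto
  also have "\<dots> = 1 + q * (p / (1 - p))"
    using p by (simp add: score_def divide_simps) (simp add: power2_eq_square power3_eq_cube algebra_simps)
  also have "\<dots> \<le> exp (q * (p / (1 - p)))"
    by (rule exp_ge_add_one_self)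
  finally show ?thesis .
qed

text \<open>The quadratic Taylor coefficient at 0 of the left-hand side is the threshold for \<open>q\<close>; any larger
value dominates near 0. The product is the factor of an edge with one endpoint in the planted set
of each of the two likelihood ratios (\<open>u = 1\<close>) or of one of them (\<open>u = 0\<close>), tilted by \<open>z\<close>.\<close>

lemma tilted_factor_le_quadratic:
  fixes u z q :: real
  assumes "u + (1 + u) * z + z\<^sup>2 / 2 < q"
  shows "\<exists>x0>0. \<forall>x. \<bar>x\<bar> \<le> x0 \<longrightarrow> (1 + x) * (1 + u * x) * exp (z * x) \<le> 1 + (1 + u + z) * x + q * x\<^sup>2"
proof -
  have "((\<lambda>x. ((1 + x) * (1 + u * x) * exp (z * x) - 1 - (1 + u + z) * x) / x\<^sup>2) \<longlongrightarrow> u + (1 + u) * z + z\<^sup>2 / 2) (at 0)"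
    by (real_asymp simp: power2_eq_square algebra_simps)
  then have "\<forall>\<^sub>F x in at 0. ((1 + x) * (1 + u * x) * exp (z * x) - 1 - (1 + u + z) * x) / x\<^sup>2 < q"
    using assms by (rule order_tendstoD)
  then obtain d where d: "d > 0" "\<And>x. x \<noteq> 0 \<Longrightarrow> \<bar>x\<bar> < d \<Longrightarrow> ((1 + x) * (1 + u * x) * exp (z * x) - 1 - (1 + u + z) * x) / x\<^sup>2 < q"
    unfolding eventually_at by (auto simp: dist_real_def)
  have "(1 + x) * (1 + u * x) * exp (z * x) \<le> 1 + (1 + u + z) * x + q * x\<^sup>2" if "\<bar>x\<bar> \<le> d / 2" for x
  proof (cases "x = 0")
    case False
    then have "((1 + x) * (1 + u * x) * exp (z * x) - 1 - (1 + u + z) * x) / x\<^sup>2 < q" "x\<^sup>2 > 0"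
      using d that by auto
    then show ?thesis by (simp add: divide_less_eq)
  qed simp
  then show ?thesis using d(1) by (intro exI[of _ "d / 2"]) auto
qed

lemma exp_le_quadratic:
  fixes y :: real
  assumes "\<bar>y\<bar> \<le> 1"
  shows "exp y \<le> 1 + y + y\<^sup>2"
proof (cases "0 \<le> y")
  case True
  then show ?thesis using assms exp_bound by auto
next
  case False
  define t where "t = - y"
  have t: "0 \<le> t" "t \<le> 1" using False assms by (auto simp: t_def)
  have "1 \<le> 1 + (t\<^sup>2 / 2 + t ^ 3 / 2 + t ^ 4 / 2)" using t by simp
  also have "\<dots> = (1 - t + t\<^sup>2) * (1 + t + t\<^sup>2 / 2)"
    by (simp add: power2_eq_square power3_eq_cube power4_eq_xxxx field_simps)
  also have "\<dots> \<le> (1 - t + t\<^sup>2) * exp t"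
    using t exp_lower_Taylor_quadratic[of t] by (intro mult_left_mono) auto
  finally have "exp (- t) \<le> 1 - t + t\<^sup>2"
    by (simp add: exp_minus divide_le_eq flip: inverse_eq_divide) (simp add: inverse_eq_divide divide_le_eq)
  then show ?thesis by (simp add: t_def)
qed

text \<open>Edges with both endpoints in planted sets are so few that a constant far from sharp in the quadratic
term is enough; in exchange the coefficients may be arbitrary of size at most a multiple
of \<open>A\<close>.\<close>

lemma crude_factor_le_quadratic:
  fixes A c d d' w x :: real
  assumes A: "0 \<le> A" "A \<le> 1 / 3" and d: "\<bar>d\<bar> \<le> 3 * A" "\<bar>d'\<bar> \<le> 3 * A"
    and w: "\<bar>w\<bar> \<le> c * A" "c * A \<le> 1" "0 \<le> c" and x: "\<bar>x\<bar> \<le> 1"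
  shows "(1 + d * x) * (1 + d' * x) * exp (w * x)
    \<le> 1 + (d + d' + w) * x + ((c\<^sup>2 + 12 * c + 27) * A\<^sup>2) * x\<^sup>2"
proof -
  define y where "y = w * x"
  have y: "\<bar>y\<bar> \<le> c * A * \<bar>x\<bar>"
    unfolding y_def abs_mult using w by (intro mult_right_mono) auto
  also have "\<dots> \<le> 1 * 1" using w x A by (intro mult_mono) auto
  finally have y1: "\<bar>y\<bar> \<le> 1" by simp
  have small: "\<bar>t * x\<bar> \<le> 1" if "\<bar>t\<bar> \<le> 3 * A" for t
    unfolding abs_mult using that A x by (intro mult_le_one) auto
  have pos: "0 \<le> (1 + d * x) * (1 + d' * x)"
    using small[OF d(1)] small[OF d(2)] by (intro mult_nonneg_nonneg) (auto simp: abs_le_iff)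
  have expy: "exp y \<le> 1 + y + y\<^sup>2"
    using y1 by (intro exp_le_quadratic) auto
  have Y2: "y\<^sup>2 \<le> (c * A * \<bar>x\<bar>)\<^sup>2"
    using y by (metis abs_ge_zero power2_abs power_mono)
  have T2: "(d + d') * x * (y + y\<^sup>2) \<le> 6 * A * \<bar>x\<bar> * (2 * (c * A * \<bar>x\<bar>))"
  proof -
    have "\<bar>y + y\<^sup>2\<bar> \<le> 2 * \<bar>y\<bar>"
      using y1 abs_triangle_ineq[of y "y\<^sup>2"] mult_left_mono[OF y1, of "\<bar>y\<bar>"] by (simp add: power2_eq_square abs_mult)
    then have yy: "\<bar>y + y\<^sup>2\<bar> \<le> 2 * (c * A * \<bar>x\<bar>)" using y by linarith
    have "\<bar>(d + d') * x * (y + y\<^sup>2)\<bar> \<le> 6 * A * \<bar>x\<bar> * (2 * (c * A * \<bar>x\<bar>))"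
      unfolding abs_mult using d A yy by (intro mult_mono) auto
    then show ?thesis by linarith
  qed
  have T3: "d * d' * x\<^sup>2 * (1 + y + y\<^sup>2) \<le> 9 * A\<^sup>2 * x\<^sup>2 * 3"
  proof -
    have "y\<^sup>2 \<le> 1" using y1 by (simp add: abs_square_le_1)
    moreover have "0 \<le> 1 + y" using y1 by linarith
    ultimately have "\<bar>1 + y + y\<^sup>2\<bar> \<le> 3" using y1 by (smt (verit) zero_le_power2)
    moreover have "\<bar>d * d'\<bar> \<le> 9 * A\<^sup>2"
      unfolding abs_mult using mult_mono[OF d] A by (simp add: power2_eq_square)
    ultimately have "\<bar>d * d' * x\<^sup>2 * (1 + y + y\<^sup>2)\<bar> \<le> 9 * A\<^sup>2 * x\<^sup>2 * 3"
      unfolding abs_mult[of "d * d' * x\<^sup>2"] abs_mult[of "d * d'"] by (intro mult_mono) auto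
    then show ?thesis by linarith
  qed
  have T4: "(c * A * \<bar>x\<bar>)\<^sup>2 + 6 * A * \<bar>x\<bar> * (2 * (c * A * \<bar>x\<bar>)) + 9 * A\<^sup>2 * x\<^sup>2 * 3
    = ((c\<^sup>2 + 12 * c + 27) * A\<^sup>2) * x\<^sup>2"
  proof -
    obtain r where r: "\<bar>x\<bar> = r" "x\<^sup>2 = r\<^sup>2" by (metis power2_abs)
    show ?thesis unfolding r by (simp add: power2_eq_square algebra_simps)
  qed
  have "(1 + d * x) * (1 + d' * x) * exp y \<le> (1 + d * x) * (1 + d' * x) * (1 + y + y\<^sup>2)"
    using expy pos by (rule mult_left_mono)
  also have "\<dots> = 1 + (d + d' + w) * x + (y\<^sup>2 + (d + d') * x * (y + y\<^sup>2) + d * d' * x\<^sup>2 * (1 + y + y\<^sup>2))"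
    by (simp add: y_def power2_eq_square algebra_simps)
  also have "\<dots> \<le> 1 + (d + d' + w) * x + ((c\<^sup>2 + 12 * c + 27) * A\<^sup>2) * x\<^sup>2"
    using Y2 T2 T3 T4 by linarith
  finally show ?thesis by (simp add: y_def)
qed

section \<open>Graphs with planted vertices\<close>

definition incidences :: "'v set \<Rightarrow> 'v \<times> 'v \<Rightarrow> nat" where
  "incidences U e = of_bool (fst e \<in> U) + of_bool (snd e \<in> U)"

lemma incidences_le_2: "incidences U e \<le> 2"
  by (simp add: incidences_def)

lemma incidences_eq_sum:
  assumes "finite U"
  shows "incidences U e = (\<Sum>i\<in>U. incidences {i} e)"
proof -
  have "(\<Sum>i\<in>U. of_bool (x = i) :: nat) = of_bool (x \<in> U)" for x
    using assms by (simp add: of_bool_def)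
  then show ?thesis by (simp add: incidences_def sum.distrib)
qed

text \<open>The first three summands are the constant of \<open>crude_factor_le_quadratic\<close> for \<open>c = 2 * \<bar>z\<bar>\<close>; the term
\<open>2 * \<bar>q\<bar>\<close> pays for charging \<open>q\<close> once for each of the at most two incidences of an edge, even when
\<open>q\<close> is negative.\<close>

definition crude_constant :: "real \<Rightarrow> real \<Rightarrow> real" where
  "crude_constant z q = (2 * \<bar>z\<bar>)\<^sup>2 + 12 * (2 * \<bar>z\<bar>) + 27 + 2 * \<bar>q\<bar>"

text \<open>An edge occurs with probability \<open>p e\<close> under the null law; each endpoint in a planted set \<open>S\<close>
multiplies this by \<open>1 + A\<close>. With \<open>p e \<le> 1 / 2\<close> and \<open>A \<le> 1 / 3\<close> the product stays below 1, because
\<open>(4 / 3)\<^sup>2 \<le> 2\<close>, so no truncation at 1 occurs. Bounding \<open>p e\<close> by \<open>1 / 2\<close> also keeps the scores in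
\<open>[-1, 1]\<close>.\<close>

locale random_edges =
  fixes E :: "('v \<times> 'v) set" and p :: "'v \<times> 'v \<Rightarrow> real" and A :: real
  assumes finite_edges: "finite E"
    and prob_bounds: "e \<in> E \<Longrightarrow> 0 < p e \<and> p e \<le> 1 / 2"
    and strength_bounds: "0 < A" "A \<le> 1 / 3"
begin

definition planted_prob :: "'v set \<Rightarrow> 'v \<times> 'v \<Rightarrow> real" where
  "planted_prob S e = p e * (1 + A) ^ incidences S e"

definition law :: "'v set \<Rightarrow> ('v \<times> 'v \<Rightarrow> bool) pmf" where
  "law S = Pi_pmf E False (\<lambda>e. bernoulli_pmf (planted_prob S e))"

definition edge_ratio :: "'v set \<Rightarrow> 'v \<times> 'v \<Rightarrow> bool \<Rightarrow> real" where
  "edge_ratio S e y = 1 + ((1 + A) ^ incidences S e - 1) * score (p e) y"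

definition likelihood_ratio :: "'v set \<Rightarrow> ('v \<times> 'v \<Rightarrow> bool) \<Rightarrow> real" where
  "likelihood_ratio S X = (\<Prod>e\<in>E. edge_ratio S e (X e))"

definition degree_score :: "'v \<Rightarrow> ('v \<times> 'v \<Rightarrow> bool) \<Rightarrow> real" where
  "degree_score i X = (\<Sum>e\<in>E. real (incidences {i} e) * score (p e) (X e))"

text \<open>In a graph without loops, this is the variance of \<open>degree_score i\<close> under the null law and the Fisher
information, at 1, about the degree parameter of vertex \<open>i\<close>.\<close>

definition information :: "'v \<Rightarrow> real" where
  "information i = (\<Sum>e\<in>E. real (incidences {i} e) * (p e / (1 - p e)))"

lemma planted_prob_empty [simp]: "planted_prob {} e = p e"
  by (simp add: planted_prob_def incidences_def)

lemma strength_pow_incidences: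
  "1 \<le> (1 + A) ^ incidences S e" "(1 + A) ^ incidences S e - 1 \<le> 3 * A" "(1 + A) ^ incidences S e \<le> 2"
proof -
  have A2: "A * A \<le> 1 / 3 * (1 / 3)" using strength_bounds by (intro mult_mono) auto
  have "incidences S e = 0 \<or> incidences S e = 1 \<or> incidences S e = 2"
    using incidences_le_2[of S e] by linarith
  then show "1 \<le> (1 + A) ^ incidences S e" "(1 + A) ^ incidences S e - 1 \<le> 3 * A" "(1 + A) ^ incidences S e \<le> 2"
    using strength_bounds A2 by (auto simp: power2_eq_square distrib_left distrib_right)
qed

lemma planted_prob_bounds:
  assumes "e \<in> E"
  shows "0 < planted_prob S e" "planted_prob S e \<le> 1"
proof -
  show "0 < planted_prob S e"
    using prob_bounds[OF assms] strength_bounds by (simp add: planted_prob_def)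
  have "planted_prob S e \<le> 1 / 2 * 2"
    unfolding planted_prob_def using prob_bounds[OF assms] strength_pow_incidences[of S e]
    by (intro mult_mono) auto
  then show "planted_prob S e \<le> 1" by simp
qed

lemma edge_ratio_nonneg:
  assumes "e \<in> E"
  shows "0 \<le> edge_ratio S e y"
proof -
  have "\<bar>((1 + A) ^ incidences S e - 1) * score (p e) y\<bar> \<le> 1"
    unfolding abs_mult using abs_score_le_1 prob_bounds[OF assms] strength_pow_incidences[of S e]
    by (intro mult_le_one) auto
  then show ?thesis unfolding edge_ratio_def by linarith
qed

lemma likelihood_ratio_nonneg: "0 \<le> likelihood_ratio S X"
  unfolding likelihood_ratio_def by (intro prod_nonneg) (auto intro: edge_ratio_nonneg)

lemma finite_support_law: "finite (set_pmf (law S))"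
  unfolding law_def using finite_edges
  by (intro finite_subset[OF set_Pi_pmf_subset'] finite_PiE_dflt) (auto intro: finite_subset[OF subset_UNIV])

lemma integrable_law [simp]:
  fixes f :: "_ \<Rightarrow> real"
  shows "integrable (measure_pmf (law S)) f"
  by (rule integrable_measure_pmf_finite) (rule finite_support_law)

lemma law_eq_likelihood_ratio:
  "pmf (law S) X = likelihood_ratio S X * pmf (law {}) X"
proof (cases "\<forall>e. e \<notin> E \<longrightarrow> X e = False")
  case True
  have "pmf (bernoulli_pmf (planted_prob S e)) y = edge_ratio S e y * pmf (bernoulli_pmf (p e)) y" if "e \<in> E" for e y
    using prob_bounds[OF that] planted_prob_bounds[OF that, of S]
    by (cases y) (auto simp: planted_prob_def edge_ratio_def score_def divide_simps, simp_all add: algebra_simps)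
  then show ?thesis
    using True finite_edges
    by (subst (1 2) law_def, subst (1 2) pmf_Pi') (auto simp: likelihood_ratio_def simp flip: prod.distrib)
next
  case False
  then have "pmf (law S') X = 0" for S'
    unfolding law_def using finite_edges by (intro pmf_Pi_outside) auto
  then show ?thesis by simp
qed

lemma prob_law_eq:
  "measure_pmf.prob (law S) B = measure_pmf.expectation (law {}) (\<lambda>X. likelihood_ratio S X * indicator B X)"
proof -
  let ?F = "set_pmf (law {}) \<union> set_pmf (law S)"
  have "measure_pmf.prob (law S) B = measure_pmf.expectation (law S) (indicator B)"
    by simp
  also have "\<dots> = (\<Sum>X\<in>?F. indicator B X * pmf (law S) X)"
    by (rule integral_measure_pmf_real) (use finite_support_law in auto)
  also have "\<dots> = (\<Sum>X\<in>?F. (likelihood_ratio S X * indicator B X) * pmf (law {}) X)"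
    by (intro sum.cong) (auto simp: law_eq_likelihood_ratio[of S])
  also have "\<dots> = measure_pmf.expectation (law {}) (\<lambda>X. likelihood_ratio S X * indicator B X)"
    by (rule integral_measure_pmf_real[symmetric]) (use finite_support_law in auto)
  finally show ?thesis .
qed

lemma expectation_likelihood_ratio: "measure_pmf.expectation (law {}) (likelihood_ratio S) = 1"
  using prob_law_eq[of S UNIV] by simp

lemma sum_degree_score:
  assumes "finite U"
  shows "(\<Sum>i\<in>U. degree_score i X) = (\<Sum>e\<in>E. real (incidences U e) * score (p e) (X e))"
  unfolding degree_score_def
  by (subst sum.swap) (simp add: incidences_eq_sum[OF assms] sum_distrib_right)

lemma sum_information:
  assumes "finite U"
  shows "(\<Sum>i\<in>U. information i) = (\<Sum>e\<in>E. real (incidences U e) * (p e / (1 - p e)))"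
  unfolding information_def incidences_eq_sum[OF assms] of_nat_sum sum_distrib_right
  by (rule sum.swap)

text \<open>The sets \<open>S\<close>, \<open>S'\<close>, \<open>U\<close> occur below in two configurations: \<open>S' = {}\<close> and \<open>U = {i}\<close> with \<open>i \<in> S\<close> for
the first moment (\<open>u = 0\<close>), and \<open>U = S \<inter> S'\<close> for the second moment (\<open>u = 1\<close>). An edge meeting
\<open>S \<union> S'\<close> in one vertex outside \<open>U\<close> contributes a single centred factor and hence has expectation 1;
if that vertex is in \<open>U\<close> the sharp constant \<open>q\<close> is paid.\<close>

lemma expectation_tilted_edge_le:
  assumes e: "e \<in> E" and U: "U \<subseteq> S" "S \<inter> S' \<subseteq> U" "\<And>x. x \<in> U \<Longrightarrow> of_bool (x \<in> S') = u"
    and z: "2 * \<bar>z\<bar> * A \<le> 1"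
    and q: "\<And>x. \<bar>x\<bar> \<le> A \<Longrightarrow> (1 + x) * (1 + u * x) * exp (z * x) \<le> 1 + (1 + u + z) * x + q * x\<^sup>2"
  shows "measure_pmf.expectation (bernoulli_pmf (p e))
      (\<lambda>y. edge_ratio S e y * edge_ratio S' e y * exp (z * A * (incidences U e * score (p e) y)))
    \<le> exp ((q * A\<^sup>2 * incidences U e
        + crude_constant z q * A\<^sup>2 * of_bool (fst e \<in> S \<union> S' \<and> snd e \<in> S \<union> S')) * (p e / (1 - p e)))"
    (is "?L \<le> _")
proof (cases "fst e \<in> S \<union> S' \<and> snd e \<in> S \<union> S'")
  case True
  let ?m = "real (incidences U e)"
  let ?K = "(2 * \<bar>z\<bar>)\<^sup>2 + 12 * (2 * \<bar>z\<bar>) + 27"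
  have m: "0 \<le> ?m" "?m \<le> 2" using incidences_le_2[of U e] by auto
  have "?L \<le> exp (?K * A\<^sup>2 * (p e / (1 - p e)))"
  proof (rule expectation_bernoulli_le_exp)
    fix y
    have "\<bar>z * A * ?m\<bar> \<le> 2 * \<bar>z\<bar> * A"
      using mult_left_mono[OF m(2), of "\<bar>z\<bar> * A"] strength_bounds by (simp add: abs_mult mult_ac)
    then show "edge_ratio S e y * edge_ratio S' e y * exp (z * A * (?m * score (p e) y))
      \<le> 1 + (((1 + A) ^ incidences S e - 1) + ((1 + A) ^ incidences S' e - 1) + z * A * ?m) * score (p e) y
          + ?K * A\<^sup>2 * (score (p e) y)\<^sup>2"
      unfolding edge_ratio_def
      using crude_factor_le_quadratic[of A "(1 + A) ^ incidences S e - 1" "(1 + A) ^ incidences S' e - 1"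
          "z * A * ?m" "2 * \<bar>z\<bar>" "score (p e) y"] z strength_bounds strength_pow_incidences[of S e]
        strength_pow_incidences[of S' e] abs_score_le_1[of "p e" y] prob_bounds[OF e]
      by (simp only: mult.assoc)
  qed (use prob_bounds[OF e] in auto)
  also have "?K * A\<^sup>2 \<le> q * A\<^sup>2 * ?m + crude_constant z q * A\<^sup>2"
  proof -
    have "\<bar>q * ?m\<bar> \<le> \<bar>q\<bar> * 2"
      unfolding abs_mult using m by (intro mult_left_mono) auto
    then have "?K \<le> q * ?m + crude_constant z q" unfolding crude_constant_def by linarith
    from mult_right_mono[OF this, of "A\<^sup>2"] show ?thesis by (simp add: algebra_simps)
  qed
  then have "exp (?K * A\<^sup>2 * (p e / (1 - p e)))
      \<le> exp ((q * A\<^sup>2 * ?m + crude_constant z q * A\<^sup>2) * (p e / (1 - p e)))"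
    using prob_bounds[OF e] by (subst exp_le_cancel_iff, intro mult_right_mono) auto
  finally show ?thesis using True by simp
next
  case False
  obtain x where x: "\<And>V. V \<subseteq> S \<union> S' \<Longrightarrow> incidences V e = of_bool (x \<in> V)"
  proof (cases "fst e \<in> S \<union> S'")
    case True
    then have "snd e \<notin> V" if "V \<subseteq> S \<union> S'" for V using False that by auto
    then show ?thesis using that[of "fst e"] by (simp add: incidences_def)
  next
    case False
    then have "fst e \<notin> V" if "V \<subseteq> S \<union> S'" for V using that by auto
    then show ?thesis using that[of "snd e"] by (simp add: incidences_def)
  qed
  then have inc: "incidences S e = of_bool (x \<in> S)" "incidences S' e = of_bool (x \<in> S')" "incidences U e = of_bool (x \<in> U)"
    using x[of S] x[of S'] x[of U] U by blast+
  show ?thesis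
  proof (cases "x \<in> U")
    case True
    have xS: "x \<in> S" using True U by auto
    have "?L \<le> exp (q * A\<^sup>2 * (p e / (1 - p e)))"
    proof (rule expectation_bernoulli_le_exp)
      fix y
      have "\<bar>A * score (p e) y\<bar> \<le> A"
        using strength_bounds abs_score_le_1[of "p e" y] prob_bounds[OF e] by (simp add: abs_mult mult_left_le)
      from q[OF this]
      show "edge_ratio S e y * edge_ratio S' e y * exp (z * A * (incidences U e * score (p e) y))
        \<le> 1 + (1 + u + z) * A * score (p e) y + q * A\<^sup>2 * (score (p e) y)\<^sup>2"
        using True xS U(3)[OF True]
        by (simp add: edge_ratio_def inc power_mult_distrib mult_ac of_bool_def split: if_splits)
    qed (use prob_bounds[OF e] in auto)
    then show ?thesis using False True inc by auto
  next
    case notU: False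
    obtain T where T: "\<And>y. edge_ratio S e y * edge_ratio S' e y = edge_ratio T e y" 
    proof (cases "x \<in> S")
      case True
      then have "x \<notin> S'" using notU U by auto
      then show ?thesis using that[of S] inc by (simp add: edge_ratio_def[of S'])
    next
      case False
      then show ?thesis using that[of S'] inc by (simp add: edge_ratio_def[of S])
    qed
    \<comment> \<open>A single factor is affine in the score, so the quadratic coefficient is 0.\<close>
    have "?L \<le> exp (0 * (p e / (1 - p e)))"
      unfolding T using prob_bounds[OF e] inc notU
      by (intro expectation_bernoulli_le_exp[where l = "(1 + A) ^ incidences T e - 1"]) (auto simp: edge_ratio_def)
    then show ?thesis using False notU inc by auto
  qed
qed

text \<open>Both likelihood ratios and the exponential tilt are products over edges, so independence turns the
expectation into a product of one-edge expectations. The main term is \<open>q * A\<^sup>2\<close> times the information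
of each tilted vertex; edges inside \<open>S \<union> S'\<close> enter only through the error term.\<close>

lemma expectation_tilted_ratios_le:
  assumes fin: "finite U" and U: "U \<subseteq> S" "S \<inter> S' \<subseteq> U" "\<And>x. x \<in> U \<Longrightarrow> of_bool (x \<in> S') = u"
    and z: "2 * \<bar>z\<bar> * A \<le> 1"
    and q: "\<And>x. \<bar>x\<bar> \<le> A \<Longrightarrow> (1 + x) * (1 + u * x) * exp (z * x) \<le> 1 + (1 + u + z) * x + q * x\<^sup>2"
  shows "measure_pmf.expectation (law {})
      (\<lambda>X. likelihood_ratio S X * likelihood_ratio S' X * exp (z * A * (\<Sum>i\<in>U. degree_score i X)))
    \<le> exp (q * A\<^sup>2 * (\<Sum>i\<in>U. information i)
        + crude_constant z q * A\<^sup>2 * (\<Sum>e\<in>{e\<in>E. fst e \<in> S \<union> S' \<and> snd e \<in> S \<union> S'}. p e / (1 - p e)))"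
proof -
  let ?f = "\<lambda>e y. edge_ratio S e y * edge_ratio S' e y * exp (z * A * (incidences U e * score (p e) y))"
  let ?g = "\<lambda>e. (q * A\<^sup>2 * incidences U e
        + crude_constant z q * A\<^sup>2 * of_bool (fst e \<in> S \<union> S' \<and> snd e \<in> S \<union> S')) * (p e / (1 - p e))"
  have "measure_pmf.expectation (law {})
      (\<lambda>X. likelihood_ratio S X * likelihood_ratio S' X * exp (z * A * (\<Sum>i\<in>U. degree_score i X)))
    = measure_pmf.expectation (law {}) (\<lambda>X. \<Prod>e\<in>E. ?f e (X e))"
    by (simp add: likelihood_ratio_def sum_degree_score[OF fin] sum_distrib_left exp_sum[OF finite_edges] prod.distrib)
  also have "\<dots> = (\<Prod>e\<in>E. measure_pmf.expectation (bernoulli_pmf (p e)) (?f e))"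
    unfolding law_def planted_prob_empty using finite_edges
    by (intro expectation_prod_Pi_pmf) (auto intro!: integrable_measure_pmf_finite mult_nonneg_nonneg edge_ratio_nonneg)
  also have "\<dots> \<le> (\<Prod>e\<in>E. exp (?g e))"
    by (intro prod_mono conjI expectation_tilted_edge_le[OF _ U z q] Bochner_Integration.integral_nonneg)
       (auto intro!: mult_nonneg_nonneg edge_ratio_nonneg)
  also have "\<dots> = exp (\<Sum>e\<in>E. ?g e)"
    by (simp add: exp_sum[OF finite_edges])
  also have "(\<Sum>e\<in>E. ?g e) = q * A\<^sup>2 * (\<Sum>i\<in>U. information i)
        + crude_constant z q * A\<^sup>2 * (\<Sum>e\<in>{e\<in>E. fst e \<in> S \<union> S' \<and> snd e \<in> S \<union> S'}. p e / (1 - p e))"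
  proof -
    have "(\<Sum>e\<in>E. ?g e) = (\<Sum>e\<in>E. q * A\<^sup>2 * (incidences U e * (p e / (1 - p e)))
        + crude_constant z q * A\<^sup>2 * (if fst e \<in> S \<union> S' \<and> snd e \<in> S \<union> S' then p e / (1 - p e) else 0))"
      by (intro sum.cong) (simp_all del: times_divide_eq_right add: distrib_right mult.assoc)
    then show ?thesis
      unfolding sum_information[OF fin] sum.distrib sum.inter_filter[OF finite_edges] sum_distrib_left .
  qed
  finally show ?thesis .
qed

end

section \<open>The truncated second moment method\<close>

text \<open>With \<open>H\<close> the average of the \<open>g S\<close>, the sum of the two error probabilities is at least the integral of
\<open>min 1 H\<close>, hence at least \<open>1 - E \<bar>H - 1\<bar>\<close>, and Cauchy-Schwarz reduces this to the first two moments
of \<open>H\<close>. Passing from \<open>f\<close> to a smaller \<open>g\<close> costs only the loss \<open>\<epsilon>\<close> in the first moment, but can lower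
the second moment dramatically.\<close>

lemma truncated_second_moment_bound:
  fixes M :: "'a pmf" and f g :: "'b \<Rightarrow> 'a \<Rightarrow> real"
  assumes fin: "finite (set_pmf M)" "finite F" "F \<noteq> {}"
    and g: "\<And>S x. S \<in> F \<Longrightarrow> 0 \<le> g S x \<and> g S x \<le> f S x"
    and first: "\<And>S. S \<in> F \<Longrightarrow> 1 - \<epsilon> \<le> measure_pmf.expectation M (g S)"
    and second: "(\<Sum>S\<in>F. \<Sum>S'\<in>F. measure_pmf.expectation M (\<lambda>x. g S x * g S' x)) \<le> (real (card F))\<^sup>2 * (1 + \<eta>)"
  shows "1 - sqrt (2 * \<epsilon> + \<eta>) \<le> measure_pmf.prob M B
    + (\<Sum>S\<in>F. measure_pmf.expectation M (\<lambda>x. f S x * indicator (- B) x)) / real (card F)"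
proof -
  let ?E = "measure_pmf.expectation M"
  have int: "integrable (measure_pmf M) h" for h :: "'a \<Rightarrow> real"
    by (rule integrable_measure_pmf_finite[OF fin(1)])
  have cF: "real (card F) > 0" using fin by (simp add: card_gt_0_iff)
  define H where "H x = (\<Sum>S\<in>F. g S x) / real (card F)" for x
  have EH: "1 - \<epsilon> \<le> ?E H"
  proof -
    have "real (card F) * (1 - \<epsilon>) \<le> (\<Sum>S\<in>F. ?E (g S))"
      using sum_mono[OF first] by simp
    then show ?thesis unfolding H_def using cF
      by (simp add: Bochner_Integration.integral_sum int pos_le_divide_eq mult.commute)
  qed
  have EH2: "?E (\<lambda>x. (H x)\<^sup>2) \<le> 1 + \<eta>"
  proof -
    have "?E (\<lambda>x. (H x)\<^sup>2) = ?E (\<lambda>x. (\<Sum>S\<in>F. \<Sum>S'\<in>F. g S x * g S' x) / (real (card F))\<^sup>2)"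
      unfolding H_def by (simp add: power_divide power2_eq_square[of "sum _ _"] sum_product)
    also have "\<dots> = (\<Sum>S\<in>F. \<Sum>S'\<in>F. ?E (\<lambda>x. g S x * g S' x)) / (real (card F))\<^sup>2"
      by (simp add: Bochner_Integration.integral_sum int)
    also have "\<dots> \<le> 1 + \<eta>" using second cF by (simp add: pos_divide_le_eq mult.commute)
    finally show ?thesis .
  qed
  have "(?E (\<lambda>x. \<bar>H x - 1\<bar>))\<^sup>2 \<le> ?E (\<lambda>x. (H x - 1)\<^sup>2)"
  proof -
    have "0 \<le> measure_pmf.variance M (\<lambda>x. \<bar>H x - 1\<bar>)" by simp
    then show ?thesis by (subst (asm) measure_pmf.variance_eq) (auto intro: int)
  qed
  also have "\<dots> = ?E (\<lambda>x. (H x)\<^sup>2 - 2 * H x + 1)"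
    by (simp add: power2_diff algebra_simps)
  also have "\<dots> = ?E (\<lambda>x. (H x)\<^sup>2) - 2 * ?E H + 1"
    by (simp add: int)
  also have "\<dots> \<le> 2 * \<epsilon> + \<eta>" using EH EH2 by linarith
  finally have "?E (\<lambda>x. \<bar>H x - 1\<bar>) \<le> sqrt (2 * \<epsilon> + \<eta>)"
    by (rule real_le_rsqrt)
  then have "1 - sqrt (2 * \<epsilon> + \<eta>) \<le> ?E (\<lambda>x. 1 - \<bar>H x - 1\<bar>)"
    by (simp add: int)
  also have "\<dots> \<le> ?E (\<lambda>x. indicator B x + (\<Sum>S\<in>F. f S x * indicator (- B) x) / real (card F))"
  proof (intro integral_mono int)
    fix x
    have "H x \<le> (\<Sum>S\<in>F. f S x) / real (card F)"
      unfolding H_def using g cF by (intro divide_right_mono sum_mono) auto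
    then show "1 - \<bar>H x - 1\<bar> \<le> indicator B x + (\<Sum>S\<in>F. f S x * indicator (- B) x) / real (card F)"
      by (cases "x \<in> B") auto
  qed
  also have "\<dots> = measure_pmf.prob M B
    + (\<Sum>S\<in>F. measure_pmf.expectation M (\<lambda>x. f S x * indicator (- B) x)) / real (card F)"
    by (simp add: Bochner_Integration.integral_sum int)
  finally show ?thesis .
qed

section \<open>Overlap of two random subsets\<close>

text \<open>For \<open>s \<le> n = card V\<close>, a uniformly random \<open>s\<close>-subset of \<open>V\<close> contains \<open>U\<close> with probability
\<open>s (s - 1) \<dots> / (n (n - 1) \<dots>)\<close>, a product of ratios that are all at most \<open>s / n\<close>.\<close>

lemma card_supersets_le:
  assumes V: "finite V" and U: "U \<subseteq> V"
  shows "real (card {S'. S' \<subseteq> V \<and> card S' = s \<and> U \<subseteq> S'})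
    \<le> (real s / real (card V)) ^ card U * real (card V choose s)"
  using V U
proof (induction "card U" arbitrary: U V s)
  case 0
  then have "U = {}" using finite_subset[of U V] by simp
  then show ?case using n_subsets[OF 0(2), of s] by simp
next
  case (Suc m)
  have finU: "finite U" using Suc.prems finite_subset by auto
  then obtain x where x: "x \<in> U" using Suc.hyps(2) by (metis card.empty ex_in_conv nat.distinct(1))
  show ?case
  proof (cases s)
    case 0
    have "S' = {}" if "S' \<subseteq> V" "card S' = s" for S'
      using that 0 finite_subset[OF that(1) Suc.prems(1)] by simp
    then have "{S'. S' \<subseteq> V \<and> card S' = s \<and> U \<subseteq> S'} = {}"
      using x by blast
    then show ?thesis by (simp only: card.empty) simp
  next
    case (Suc t)
    let ?n = "card V"
    have n: "?n > 0" "card (V - {x}) = ?n - 1" "card (U - {x}) = m"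
      using x Suc.prems finU \<open>Suc m = card U\<close> by (auto simp: card_gt_0_iff)
    \<comment> \<open>Removing a point of \<open>U\<close> from everything lowers all three cardinalities by one.\<close>
    have "bij_betw (insert x) {S'. S' \<subseteq> V - {x} \<and> card S' = t \<and> U - {x} \<subseteq> S'}
        {S'. S' \<subseteq> V \<and> card S' = s \<and> U \<subseteq> S'}"
    proof (rule bij_betw_byWitness[where f' = "\<lambda>S. S - {x}"])
      show "insert x ` {S'. S' \<subseteq> V - {x} \<and> card S' = t \<and> U - {x} \<subseteq> S'} \<subseteq> {S'. S' \<subseteq> V \<and> card S' = s \<and> U \<subseteq> S'}"
      proof clarify
        fix S' assume S': "S' \<subseteq> V - {x}" "t = card S'" "U - {x} \<subseteq> S'"
        then have "finite S'" "x \<notin> S'" using finite_subset[of S' V] Suc.prems by auto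
        then show "insert x S' \<subseteq> V \<and> card (insert x S') = s \<and> U \<subseteq> insert x S'"
          using S' x Suc.prems Suc by auto
      qed
      show "(\<lambda>S. S - {x}) ` {S'. S' \<subseteq> V \<and> card S' = s \<and> U \<subseteq> S'} \<subseteq> {S'. S' \<subseteq> V - {x} \<and> card S' = t \<and> U - {x} \<subseteq> S'}"
        using x Suc.prems Suc by (auto simp: card_Diff_singleton_if dest: finite_subset[of _ V])
    qed (use x in auto)
    then have "real (card {S'. S' \<subseteq> V \<and> card S' = s \<and> U \<subseteq> S'})
      = real (card {S'. S' \<subseteq> V - {x} \<and> card S' = t \<and> U - {x} \<subseteq> S'})"
      by (simp add: bij_betw_same_card)
    also have "\<dots> \<le> (real t / real (?n - 1)) ^ m * real ((?n - 1) choose t)"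
      using Suc.hyps(1)[of "U - {x}" "V - {x}" t] Suc.prems n by (auto simp: Diff_mono)
    also have "\<dots> \<le> (real s / real ?n) ^ m * ((real s / real ?n) * real (?n choose s))"
    proof (cases "t \<le> ?n - 1")
      case True
      have "real t / real (?n - 1) \<le> real s / real ?n"
      proof (cases "?n = 1")
        case False
        then show ?thesis using True n Suc by (simp add: frac_le_eq divide_le_eq field_simps of_nat_diff)
      qed auto
      moreover have "real ?n * real ((?n - 1) choose t) = real s * real (?n choose s)"
        using Suc_times_binomial_eq[of "?n - 1" t] n Suc by (metis Suc_diff_1 mult.commute of_nat_mult)
      then have "real ((?n - 1) choose t) = real s / real ?n * real (?n choose s)"
        using n by (simp add: field_simps)
      ultimately show ?thesis by (intro mult_mono power_mono) auto
    next
      case False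
      then show ?thesis by (simp add: binomial_eq_0)
    qed
    also have "\<dots> = (real s / real ?n) ^ card U * real (?n choose s)"
      using \<open>Suc m = card U\<close> by (simp add: algebra_simps flip: \<open>Suc m = card U\<close>)
    finally show ?thesis .
  qed
qed

lemma sum_power_card_Pow:
  fixes x :: real
  assumes "finite S"
  shows "(\<Sum>U\<in>Pow S. x ^ card U) = (1 + x) ^ card S"
proof -
  have "(\<Prod>i\<in>S. x + 1) = (\<Sum>U\<in>Pow S. (\<Prod>i\<in>U. x) * (\<Prod>i\<in>S - U. 1))"
    by (rule prod_add[OF assms])
  then show ?thesis by (simp add: add.commute)
qed

text \<open>The overlap of a fixed and a random \<open>s\<close>-set is hypergeometric, and its generating function is at most
that of a binomial variable with \<open>s\<close> trials and success probability \<open>s / n\<close>. This follows by expanding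
\<open>(1 + \<beta>) ^ card (S \<inter> S')\<close> over subsets, since each subset is contained in \<open>S'\<close> with at most the
probability that it would have for independent inclusions.\<close>

lemma sum_power_card_Int_le:
  fixes \<beta> :: real
  assumes V: "finite V" and S: "S \<subseteq> V" "card S = s" and \<beta>: "0 \<le> \<beta>"
  shows "(\<Sum>S'\<in>{S'. S' \<subseteq> V \<and> card S' = s}. \<beta> ^ card (S \<inter> S'))
    \<le> real (card V choose s) * exp (\<beta> * (real s)\<^sup>2 / real (card V))"
proof -
  let ?F = "{S'. S' \<subseteq> V \<and> card S' = s}"
  let ?n = "real (card V)"
  have finS: "finite S" using V S finite_subset by auto
  have finF: "finite ?F" using V by simp
  have "(\<Sum>S'\<in>?F. \<beta> ^ card (S \<inter> S')) \<le> (\<Sum>S'\<in>?F. (1 + \<beta>) ^ card (S \<inter> S'))"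
    using \<beta> by (intro sum_mono power_mono) auto
  also have "\<dots> = (\<Sum>S'\<in>?F. \<Sum>U\<in>{U\<in>Pow S. U \<subseteq> S'}. \<beta> ^ card U)"
  proof (rule sum.cong)
    fix S' :: "'a set"
    have "{U \<in> Pow S. U \<subseteq> S'} = Pow (S \<inter> S')" by auto
    then show "(1 + \<beta>) ^ card (S \<inter> S') = (\<Sum>U\<in>{U\<in>Pow S. U \<subseteq> S'}. \<beta> ^ card U)"
      using sum_power_card_Pow[of "S \<inter> S'" \<beta>] finS by simp
  qed simp
  also have "\<dots> = (\<Sum>U\<in>Pow S. \<Sum>S'\<in>{S'\<in>?F. U \<subseteq> S'}. \<beta> ^ card U)"
    using finS finF by (intro sum.swap_restrict) auto
  also have "\<dots> = (\<Sum>U\<in>Pow S. real (card {S'. S' \<subseteq> V \<and> card S' = s \<and> U \<subseteq> S'}) * \<beta> ^ card U)"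
    by (simp add: conj_assoc)
  also have "\<dots> \<le> (\<Sum>U\<in>Pow S. ((real s / ?n) ^ card U * real (card V choose s)) * \<beta> ^ card U)"
    using V S \<beta> by (intro sum_mono mult_right_mono card_supersets_le) auto
  also have "\<dots> = real (card V choose s) * (\<Sum>U\<in>Pow S. (\<beta> * real s / ?n) ^ card U)"
    by (simp add: sum_distrib_left power_mult_distrib power_divide mult_ac)
  also have "\<dots> = real (card V choose s) * (1 + \<beta> * real s / ?n) ^ s"
    using sum_power_card_Pow[OF finS] S by simp
  also have "(1 + \<beta> * real s / ?n) ^ s \<le> exp (\<beta> * real s / ?n) ^ s"
    using \<beta> by (intro power_mono exp_ge_add_one_self) auto
  also have "\<dots> = exp (\<beta> * (real s)\<^sup>2 / ?n)"
    by (simp add: exp_of_nat_mult[symmetric] power2_eq_square mult_ac)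
  finally show ?thesis by (simp add: mult_left_mono)
qed

section \<open>Truncated likelihood ratios\<close>

context random_edges
begin

definition truncated_ratio :: "real \<Rightarrow> 'v set \<Rightarrow> ('v \<times> 'v \<Rightarrow> bool) \<Rightarrow> real" where
  "truncated_ratio c S X = likelihood_ratio S X * of_bool (\<forall>i\<in>S. A * degree_score i X \<le> c)"

definition internal_information :: "'v set \<Rightarrow> real" where
  "internal_information W = (\<Sum>e\<in>{e\<in>E. fst e \<in> W \<and> snd e \<in> W}. p e / (1 - p e))"

lemma truncated_ratio_bounds: "0 \<le> truncated_ratio c S X \<and> truncated_ratio c S X \<le> likelihood_ratio S X"
  by (simp add: truncated_ratio_def likelihood_ratio_nonneg)

text \<open>The truncation removes the event that some planted vertex has a large degree score. Its probability
under the planted law is bounded by Chernoff's inequality with parameter \<open>\<mu>\<close> and a union bound. The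
planted law shifts the mean of \<open>A * degree_score i\<close> to about \<open>A\<^sup>2 * information i\<close>; hence the linear
term in \<open>\<mu> + \<mu>\<^sup>2 / 2\<close>, the smallest possible value of \<open>q\<close>.\<close>

lemma expectation_truncated_ratio_ge:
  assumes S: "finite S" and \<mu>: "0 \<le> \<mu>" "2 * \<mu> * A \<le> 1"
    and q: "\<And>x. \<bar>x\<bar> \<le> A \<Longrightarrow> (1 + x) * exp (\<mu> * x) \<le> 1 + (1 + \<mu>) * x + q * x\<^sup>2"
  shows "1 - (\<Sum>i\<in>S. exp (q * A\<^sup>2 * information i + crude_constant \<mu> q * A\<^sup>2 * internal_information S - \<mu> * c))
    \<le> measure_pmf.expectation (law {}) (truncated_ratio c S)"
proof -
  let ?E = "measure_pmf.expectation (law {})"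
  have empty: "likelihood_ratio {} X = 1" for X
    by (simp add: likelihood_ratio_def edge_ratio_def incidences_def)
  have "?E (\<lambda>X. likelihood_ratio S X * exp (\<mu> * (A * degree_score i X - c)))
    \<le> exp (q * A\<^sup>2 * information i + crude_constant \<mu> q * A\<^sup>2 * internal_information S - \<mu> * c)" if i: "i \<in> S" for i
  proof -
    have "?E (\<lambda>X. likelihood_ratio S X * exp (\<mu> * (A * degree_score i X - c)))
      = ?E (\<lambda>X. likelihood_ratio S X * likelihood_ratio {} X * exp (\<mu> * A * (\<Sum>j\<in>{i}. degree_score j X))) * exp (- (\<mu> * c))"
      by (simp add: empty right_diff_distrib exp_diff exp_minus mult.assoc divide_inverse flip: integral_mult_left_zero)
    also have "\<dots> \<le> exp (q * A\<^sup>2 * (\<Sum>j\<in>{i}. information j) + crude_constant \<mu> q * A\<^sup>2 * internal_information S) * exp (- (\<mu> * c))"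
      using expectation_tilted_ratios_le[of "{i}" S "{}" 0 \<mu> q] i \<mu> q
      by (intro mult_right_mono) (auto simp: internal_information_def)
    finally show ?thesis by (simp add: exp_add exp_diff exp_minus divide_inverse)
  qed
  then have "?E (\<lambda>X. \<Sum>i\<in>S. likelihood_ratio S X * exp (\<mu> * (A * degree_score i X - c)))
    \<le> (\<Sum>i\<in>S. exp (q * A\<^sup>2 * information i + crude_constant \<mu> q * A\<^sup>2 * internal_information S - \<mu> * c))"
    by (simp add: Bochner_Integration.integral_sum sum_mono)
  moreover have "?E (likelihood_ratio S) - ?E (truncated_ratio c S)
    \<le> ?E (\<lambda>X. \<Sum>i\<in>S. likelihood_ratio S X * exp (\<mu> * (A * degree_score i X - c)))"
    unfolding Bochner_Integration.integral_diff[OF integrable_law integrable_law, symmetric]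
  proof (intro integral_mono integrable_law)
    fix X
    show "likelihood_ratio S X - truncated_ratio c S X \<le> (\<Sum>i\<in>S. likelihood_ratio S X * exp (\<mu> * (A * degree_score i X - c)))"
    proof (cases "\<forall>i\<in>S. A * degree_score i X \<le> c")
      case True
      then show ?thesis by (auto simp: truncated_ratio_def intro!: sum_nonneg mult_nonneg_nonneg likelihood_ratio_nonneg)
    next
      case False
      then obtain i where i: "i \<in> S" "A * degree_score i X > c" by auto
      have "likelihood_ratio S X - truncated_ratio c S X \<le> likelihood_ratio S X * 1"
        using truncated_ratio_bounds[of c S X] by simp
      also have "\<dots> \<le> likelihood_ratio S X * exp (\<mu> * (A * degree_score i X - c))"
        using \<mu> i by (intro mult_left_mono likelihood_ratio_nonneg) auto
      also have "\<dots> \<le> (\<Sum>i\<in>S. likelihood_ratio S X * exp (\<mu> * (A * degree_score i X - c)))"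
        using i S by (intro member_le_sum) (auto intro!: mult_nonneg_nonneg likelihood_ratio_nonneg)
      finally show ?thesis .
    qed
  qed
  ultimately show ?thesis using expectation_likelihood_ratio[of S] by linarith
qed

text \<open>The two indicators are replaced by \<open>exp (\<kappa> * (c - A * degree_score i))\<close>, one factor for each common
planted vertex. This upper bound keeps the product structure over edges, which the indicators do not
have, and the best \<open>\<kappa>\<close> gives the exponent of a truncated Gaussian moment.\<close>

lemma expectation_truncated_ratios_le:
  assumes S: "finite S" and \<kappa>: "0 \<le> \<kappa>" "2 * \<kappa> * A \<le> 1"
    and q: "\<And>x. \<bar>x\<bar> \<le> A \<Longrightarrow> (1 + x)\<^sup>2 * exp (- \<kappa> * x) \<le> 1 + (2 - \<kappa>) * x + q * x\<^sup>2"
  shows "measure_pmf.expectation (law {}) (\<lambda>X. truncated_ratio c S X * truncated_ratio c S' X)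
    \<le> exp (q * A\<^sup>2 * (\<Sum>i\<in>S \<inter> S'. information i)
        + crude_constant (- \<kappa>) q * A\<^sup>2 * internal_information (S \<union> S') + real (card (S \<inter> S')) * (\<kappa> * c))"
proof -
  let ?E = "measure_pmf.expectation (law {})" and ?U = "S \<inter> S'"
  have "?E (\<lambda>X. truncated_ratio c S X * truncated_ratio c S' X)
    \<le> ?E (\<lambda>X. likelihood_ratio S X * likelihood_ratio S' X * exp (- \<kappa> * A * (\<Sum>i\<in>?U. degree_score i X)) * exp (real (card ?U) * (\<kappa> * c)))"
  proof (intro integral_mono integrable_law)
    fix X
    have "of_bool (\<forall>i\<in>S. A * degree_score i X \<le> c) * of_bool (\<forall>i\<in>S'. A * degree_score i X \<le> c)
      \<le> exp (- \<kappa> * A * (\<Sum>i\<in>?U. degree_score i X) + real (card ?U) * (\<kappa> * c))"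
    proof (cases "(\<forall>i\<in>S. A * degree_score i X \<le> c) \<and> (\<forall>i\<in>S'. A * degree_score i X \<le> c)")
      case True
      then have "(\<Sum>i\<in>?U. A * degree_score i X) \<le> (\<Sum>i\<in>?U. c)" by (intro sum_mono) auto
      then have "A * (\<Sum>i\<in>?U. degree_score i X) \<le> real (card ?U) * c" by (simp add: sum_distrib_left)
      from mult_left_mono[OF this \<kappa>(1)] show ?thesis by (simp add: mult_ac)
    qed auto
    from mult_left_mono[OF this mult_nonneg_nonneg[OF likelihood_ratio_nonneg[of S X] likelihood_ratio_nonneg[of S' X]]]
    show "truncated_ratio c S X * truncated_ratio c S' X
      \<le> likelihood_ratio S X * likelihood_ratio S' X * exp (- \<kappa> * A * (\<Sum>i\<in>?U. degree_score i X)) * exp (real (card ?U) * (\<kappa> * c))"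
      by (simp only: truncated_ratio_def exp_add mult_ac)
  qed
  also have "\<dots> = ?E (\<lambda>X. likelihood_ratio S X * likelihood_ratio S' X * exp (- \<kappa> * A * (\<Sum>i\<in>?U. degree_score i X))) * exp (real (card ?U) * (\<kappa> * c))"
    by simp
  also have "\<dots> \<le> exp (q * A\<^sup>2 * (\<Sum>i\<in>?U. information i)
        + crude_constant (- \<kappa>) q * A\<^sup>2 * internal_information (S \<union> S')) * exp (real (card ?U) * (\<kappa> * c))"
  proof (rule mult_right_mono)
    have "(1 + x) * (1 + 1 * x) * exp (- \<kappa> * x) \<le> 1 + (1 + 1 + - \<kappa>) * x + q * x\<^sup>2" if "\<bar>x\<bar> \<le> A" for x
      using q[OF that] by (simp add: power2_eq_square)
    then show "?E (\<lambda>X. likelihood_ratio S X * likelihood_ratio S' X * exp (- \<kappa> * A * (\<Sum>i\<in>?U. degree_score i X)))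
      \<le> exp (q * A\<^sup>2 * (\<Sum>i\<in>?U. information i) + crude_constant (- \<kappa>) q * A\<^sup>2 * internal_information (S \<union> S'))"
      unfolding internal_information_def using S \<kappa> by (intro expectation_tilted_ratios_le[where u = 1]) auto
  qed simp
  finally show ?thesis by (simp add: exp_add)
qed

text \<open>A finite bound for the testing problem with a planted set uniformly distributed over the \<open>s\<close>-subsets:
\<open>x1\<close> and \<open>x2\<close> bound the exponents paid per planted vertex in the first and second moment, \<open>x0\<close> the
contribution of the edges inside planted sets, and \<open>c\<close> is the truncation level.\<close>

theorem average_error_ge:
  assumes V: "finite V" "s \<le> card V" and \<mu>: "0 \<le> \<mu>" "2 * \<mu> * A \<le> 1" and \<kappa>: "0 \<le> \<kappa>" "2 * \<kappa> * A \<le> 1"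
    and q1: "\<And>x. \<bar>x\<bar> \<le> A \<Longrightarrow> (1 + x) * exp (\<mu> * x) \<le> 1 + (1 + \<mu>) * x + q1 * x\<^sup>2"
    and q2: "\<And>x. \<bar>x\<bar> \<le> A \<Longrightarrow> (1 + x)\<^sup>2 * exp (- \<kappa> * x) \<le> 1 + (2 - \<kappa>) * x + q2 * x\<^sup>2"
    and info: "\<And>i. i \<in> V \<Longrightarrow> q1 * A\<^sup>2 * information i \<le> x1" "\<And>i. i \<in> V \<Longrightarrow> q2 * A\<^sup>2 * information i \<le> x2"
    and internal: "\<And>W. W \<subseteq> V \<Longrightarrow> card W \<le> 2 * s \<Longrightarrow> crude_constant \<mu> q1 * A\<^sup>2 * internal_information W \<le> x0"
      "\<And>W. W \<subseteq> V \<Longrightarrow> card W \<le> 2 * s \<Longrightarrow> crude_constant (- \<kappa>) q2 * A\<^sup>2 * internal_information W \<le> x0"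
  shows "1 - sqrt (2 * (real s * exp (x1 + x0 - \<mu> * c))
      + (exp (x0 + exp (x2 + \<kappa> * c) * (real s)\<^sup>2 / real (card V)) - 1))
    \<le> measure_pmf.prob (law {}) B
      + (\<Sum>S\<in>{S. S \<subseteq> V \<and> card S = s}. measure_pmf.prob (law S) (- B)) / real (card V choose s)"
proof -
  let ?F = "{S. S \<subseteq> V \<and> card S = s}"
  have cardF: "card ?F = card V choose s" using n_subsets[OF V(1)] by simp
  obtain S0 where "S0 \<subseteq> V" "card S0 = s" using V by (meson obtain_subset_with_card_n)
  then have F: "finite ?F" "?F \<noteq> {}" using V by auto
  have finS: "finite S" if "S \<in> ?F" for S using that V finite_subset by auto
  have first: "1 - real s * exp (x1 + x0 - \<mu> * c) \<le> measure_pmf.expectation (law {}) (truncated_ratio c S)" if S: "S \<in> ?F" for S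
  proof -
    have "(\<Sum>i\<in>S. exp (q1 * A\<^sup>2 * information i + crude_constant \<mu> q1 * A\<^sup>2 * internal_information S - \<mu> * c))
      \<le> (\<Sum>i\<in>S. exp (x1 + x0 - \<mu> * c))"
      using S info(1) internal(1)[of S] by (intro sum_mono) (auto intro!: add_mono)
    also have "\<dots> = real s * exp (x1 + x0 - \<mu> * c)" using S by simp
    finally show ?thesis using expectation_truncated_ratio_ge[OF finS[OF S] \<mu> q1, of c] by linarith
  qed
  have second: "measure_pmf.expectation (law {}) (\<lambda>X. truncated_ratio c S X * truncated_ratio c S' X)
    \<le> exp x0 * exp (x2 + \<kappa> * c) ^ card (S \<inter> S')" if S: "S \<in> ?F" "S' \<in> ?F" for S S'
  proof -
    have "q2 * A\<^sup>2 * (\<Sum>i\<in>S \<inter> S'. information i) \<le> (\<Sum>i\<in>S \<inter> S'. x2)"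
      unfolding sum_distrib_left using S info(2) by (intro sum_mono) auto
    moreover have "card (S \<union> S') \<le> 2 * s" using card_Un_le[of S S'] S by auto
    then have "crude_constant (- \<kappa>) q2 * A\<^sup>2 * internal_information (S \<union> S') \<le> x0"
      using S by (intro internal(2)) auto
    ultimately have "exp (q2 * A\<^sup>2 * (\<Sum>i\<in>S \<inter> S'. information i)
        + crude_constant (- \<kappa>) q2 * A\<^sup>2 * internal_information (S \<union> S') + real (card (S \<inter> S')) * (\<kappa> * c))
      \<le> exp (x0 + real (card (S \<inter> S')) * (x2 + \<kappa> * c))"
      by (simp add: distrib_left)
    also have "\<dots> = exp x0 * exp (x2 + \<kappa> * c) ^ card (S \<inter> S')"
      by (simp only: exp_add exp_of_nat_mult)
    finally show ?thesis using expectation_truncated_ratios_le[OF finS[OF S(1)] \<kappa> q2, of c S'] by linarith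
  qed
  let ?b = "exp (x2 + \<kappa> * c)"
  have "(\<Sum>S\<in>?F. \<Sum>S'\<in>?F. measure_pmf.expectation (law {}) (\<lambda>X. truncated_ratio c S X * truncated_ratio c S' X))
    \<le> (\<Sum>S\<in>?F. exp x0 * (\<Sum>S'\<in>?F. ?b ^ card (S \<inter> S')))"
    unfolding sum_distrib_left by (intro sum_mono second)
  also have "\<dots> \<le> (\<Sum>S\<in>?F. exp x0 * (real (card V choose s) * exp (?b * (real s)\<^sup>2 / real (card V))))"
    using V by (intro sum_mono mult_left_mono sum_power_card_Int_le) auto
  also have "\<dots> = (real (card ?F))\<^sup>2 * (1 + (exp (x0 + ?b * (real s)\<^sup>2 / real (card V)) - 1))"
    by (simp add: cardF exp_add power2_eq_square)
  finally have "1 - sqrt (2 * (real s * exp (x1 + x0 - \<mu> * c)) + (exp (x0 + ?b * (real s)\<^sup>2 / real (card V)) - 1))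
    \<le> measure_pmf.prob (law {}) B
      + (\<Sum>S\<in>?F. measure_pmf.expectation (law {}) (\<lambda>X. likelihood_ratio S X * indicator (- B) X)) / real (card ?F)"
    by (intro truncated_second_moment_bound[OF finite_support_law F truncated_ratio_bounds first])
  then show ?thesis unfolding cardF prob_law_eq[symmetric] .
qed

end

section \<open>Balanced community assignments\<close>

text \<open>For \<open>\<nu> = 1\<close> every admissible assignment has blocks of size exactly \<open>n / k\<close>. For \<open>\<nu> > 1\<close> the residue
classes modulo \<open>k\<close> differ from \<open>n / k\<close> by at most 1, which the size window allows once \<open>n\<close> is large.\<close>

lemma eventually_balanced_assignment:
  assumes "1 \<le> k" "1 \<le> \<nu>"
  shows "\<forall>\<^sub>F n in sequentially. community_assignments k \<nu> n \<noteq> {} \<longrightarrow>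
    (\<exists>P\<in>community_assignments k \<nu> n. \<forall>S\<in>P. \<bar>real (card S) - real n / real k\<bar> \<le> 1)"
proof (cases "\<nu> = 1")
  case True
  show ?thesis
  proof (rule always_eventually, intro allI impI)
    fix n
    assume "community_assignments k \<nu> n \<noteq> {}"
    then obtain P where "P \<in> community_assignments k \<nu> n" by auto
    then show "\<exists>P\<in>community_assignments k \<nu> n. \<forall>S\<in>P. \<bar>real (card S) - real n / real k\<bar> \<le> 1"
      using True by (intro bexI[of _ P]) (auto simp: community_assignments_def)
  qed
next
  case False
  then have \<nu>: "\<nu> > 1" using assms by simp
  have k: "real k > 0" using assms by simp
  have "filterlim (\<lambda>n. real n * (1 / k * (1 - 1 / \<nu>))) at_top sequentially"
    using \<nu> k by (intro filterlim_at_top_mult_tendsto_pos[OF tendsto_const _ filterlim_real_sequentially]) auto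
  moreover have "filterlim (\<lambda>n. real n * ((\<nu> - 1) / k)) at_top sequentially"
    using \<nu> k by (intro filterlim_at_top_mult_tendsto_pos[OF tendsto_const _ filterlim_real_sequentially]) auto
  ultimately have "\<forall>\<^sub>F n in sequentially. 1 \<le> real n * (1 / k * (1 - 1 / \<nu>)) \<and> 1 \<le> real n * ((\<nu> - 1) / k)"
    by (auto simp: filterlim_at_top intro: eventually_conj)
  then show ?thesis using eventually_ge_at_top[of k]
  proof eventually_elim
    case (elim n)
    define block where "block r = {i\<in>{1..n}. (i - 1) mod k = r}" for r
    define m where "m = n div k"
    have m: "1 \<le> m" "m * k \<le> n" "n < (m + 1) * k"
      using elim k unfolding m_def by (auto simp: div_greater_zero_iff Suc_le_eq dividend_less_times_div mult.commute)
    have card_block: "m \<le> card (block r) \<and> card (block r) \<le> m + 1" if r: "r < k" for r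
    proof
      have inj: "inj_on (\<lambda>j. k * j + r + 1) X" for X using k by (auto simp: inj_on_def)
      have "(\<lambda>j. k * j + r + 1) ` {..<m} \<subseteq> block r"
      proof clarify
        fix j assume "j < m"
        then have "k * (j + 1) \<le> k * m" by (intro mult_left_mono) auto
        then have "k * j + r + 1 \<le> n" using r m by (simp add: mult.commute)
        then show "k * j + r + 1 \<in> block r" using r by (simp add: block_def)
      qed
      from card_mono[OF _ this] show "m \<le> card (block r)"
        unfolding card_image[OF inj] by (simp add: block_def)
      have "block r \<subseteq> (\<lambda>j. k * j + r + 1) ` {..m}"
      proof
        fix i assume i: "i \<in> block r"
        then have "i = k * ((i - 1) div k) + r + 1"
          using mult_div_mod_eq[of k "i - 1"] by (auto simp: block_def)
        moreover have "(i - 1) div k \<le> m" using i unfolding m_def block_def by (intro div_le_mono) auto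
        ultimately show "i \<in> (\<lambda>j. k * j + r + 1) ` {..m}" by blast
      qed
      from card_mono[OF _ this] show "card (block r) \<le> m + 1"
        unfolding card_image[OF inj] by simp
    qed
    have near: "\<bar>real (card (block r)) - real n / real k\<bar> \<le> 1" if "r < k" for r
    proof -
      have "real (m * k) \<le> real n" "real n \<le> real ((m + 1) * k)"
        using m unfolding of_nat_le_iff by simp_all
      then have "real m * real k \<le> real n" "real n \<le> (real m + 1) * real k"
        by (simp_all add: algebra_simps)
      then have "real m \<le> real n / real k" "real n / real k \<le> real m + 1"
        using k by (auto simp: pos_le_divide_eq pos_divide_le_eq)
      then show ?thesis using card_block[OF that] by (auto simp: abs_le_iff)
    qed
    have ne: "block r \<noteq> {}" if "r < k" for r using card_block[OF that] m by auto
    let ?P = "block ` {..<k}"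
    have "partition_on {1..n} ?P"
    proof (rule partition_onI)
      have "i \<in> \<Union> ?P" if "i \<in> {1..n}" for i
        using that assms by (intro UnionI[of "block ((i - 1) mod k)"]) (auto simp: block_def)
      then show "\<Union> ?P = {1..n}" unfolding block_def by blast
      show "disjnt S S'" if "S \<in> ?P" "S' \<in> ?P" "S \<noteq> S'" for S S'
        using that by (auto simp: disjnt_def block_def)
      show "{} \<notin> ?P" using ne by auto
    qed
    moreover have "inj_on block {..<k}"
    proof (rule inj_onI)
      fix r r' assume "r \<in> {..<k}" "r' \<in> {..<k}" "block r = block r'"
      then obtain i where "i \<in> block r" "i \<in> block r'" using ne[of r] by blast
      then show "r = r'" by (simp add: block_def)
    qed
    then have "card ?P = k" by (simp add: card_image)
    moreover have "real n / (real k * \<nu>) \<le> real (card S) \<and> real (card S) \<le> real n * \<nu> / real k" if "S \<in> ?P" for S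
    proof -
      have "real n / (real k * \<nu>) = real n / real k - real n * (1 / k * (1 - 1 / \<nu>))"
        using k \<nu> by (simp add: field_simps)
      moreover have "real n * \<nu> / real k = real n / real k + real n * ((\<nu> - 1) / k)"
        using k \<nu> by (simp add: field_simps)
      moreover have "\<bar>real (card S) - real n / real k\<bar> \<le> 1" using that near by auto
      ultimately show ?thesis using elim(1) by linarith
    qed
    ultimately have "?P \<in> community_assignments k \<nu> n"
      unfolding community_assignments_def by blast
    moreover have "\<forall>S\<in>?P. \<bar>real (card S) - real n / real k\<bar> \<le> 1"
      using near by blast
    ultimately show ?case by blast
  qed
qed

section \<open>The block model as a planted graph\<close>

definition null_prob :: "nat \<Rightarrow> nat set set \<Rightarrow> real \<Rightarrow> real \<Rightarrow> nat \<times> nat \<Rightarrow> real" where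
  "null_prob n P a b e = edge_prob n P (\<lambda>_. 1) a b (fst e) (snd e)"

definition adjacency :: "(nat \<times> nat \<Rightarrow> bool) \<Rightarrow> nat \<Rightarrow> nat \<Rightarrow> nat" where
  "adjacency X i j = of_bool (X (min i j, max i j))"

lemma finite_vertex_pairs: "finite (vertex_pairs n)"
  by (rule finite_subset[of _ "{1..n} \<times> {1..n}"]) (auto simp: vertex_pairs_def)

lemma null_prob_eq:
  assumes "0 < b" "b < a" "a \<le> real n / 2"
  shows "null_prob n P a b (i, j) = (if \<exists>S\<in>P. i \<in> S \<and> j \<in> S then a / real n else b / real n)"
  using assms by (auto simp: null_prob_def edge_prob_def min_def divide_le_eq)

lemma random_edges_null_prob:
  assumes ab: "0 < b" "b < a" "a \<le> real n / 2" and A: "0 < A" "A \<le> 1 / 3"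
  shows "random_edges (vertex_pairs n) (null_prob n P a b) A"
proof
  show "finite (vertex_pairs n)" by (rule finite_vertex_pairs)
  show "0 < null_prob n P a b e \<and> null_prob n P a b e \<le> 1 / 2" for e
    using ab by (cases e) (auto simp: null_prob_eq[OF ab] divide_le_eq)
qed (use A in auto)

lemma graph_law_eq_map_law:
  assumes ab: "0 < b" "b < a" "a \<le> real n / 2" and A: "0 < A" "A \<le> 1 / 3"
  shows "graph_law n P (\<lambda>i. if i \<in> S then 1 + A else 1) a b
    = map_pmf adjacency (random_edges.law (vertex_pairs n) (null_prob n P a b) A S)"
proof -
  interpret random_edges "vertex_pairs n" "null_prob n P a b" A
    by (rule random_edges_null_prob[OF assms])
  have "edge_prob n P (\<lambda>i. if i \<in> S then 1 + A else 1) a b i j = planted_prob S (i, j)" if "(i, j) \<in> vertex_pairs n" for i j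
  proof -
    have "edge_prob n P (\<lambda>i. if i \<in> S then 1 + A else 1) a b i j = min (planted_prob S (i, j)) 1"
      unfolding planted_prob_def null_prob_eq[OF ab] edge_prob_def incidences_def
      by (auto simp: power2_eq_square mult_ac)
    then show ?thesis using planted_prob_bounds[OF that, of S] by simp
  qed
  then have "Pi_pmf (vertex_pairs n) False (\<lambda>(i, j). bernoulli_pmf (edge_prob n P (\<lambda>i. if i \<in> S then 1 + A else 1) a b i j)) = law S"
    unfolding law_def by (intro Pi_pmf_cong) auto
  then show ?thesis unfolding graph_law_def by (simp add: adjacency_def[abs_def])
qed

lemma sum_incidences_vertex_pairs:
  fixes w :: "nat \<times> nat \<Rightarrow> real"
  assumes i: "i \<in> {1..n}"
  shows "(\<Sum>e\<in>vertex_pairs n. real (incidences {i} e) * w e) = (\<Sum>j\<in>{1..n} - {i}. w (min i j, max i j))"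
proof -
  have "(\<Sum>e\<in>vertex_pairs n. real (incidences {i} e) * w e)
    = (\<Sum>e\<in>{e\<in>vertex_pairs n. fst e = i \<or> snd e = i}. w e)"
    unfolding sum.inter_filter[OF finite_vertex_pairs]
    by (intro sum.cong) (auto simp: incidences_def vertex_pairs_def)
  also have "\<dots> = (\<Sum>j\<in>{1..n} - {i}. w (min i j, max i j))"
    using i by (intro sum.reindex_bij_witness[where i = "\<lambda>j. (min i j, max i j)" and j = "\<lambda>e. if fst e = i then snd e else fst e"])
      (auto simp: vertex_pairs_def min_def max_def)
  finally show ?thesis .
qed

text \<open>The information of a vertex under a perfectly balanced assignment. It differs from \<open>sigma_sq\<close> by
having \<open>1 - p\<close> in the denominator instead of the numerator, and this is the origin of
\<open>variance_ratio\<close>.\<close>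

definition null_information :: "nat \<Rightarrow> nat \<Rightarrow> real \<Rightarrow> real \<Rightarrow> real" where
  "null_information k n a b = real n / real k * (a / real n / (1 - a / real n))
     + (real k - 1) * real n / real k * (b / real n / (1 - b / real n))"

lemma odds_bounds:
  fixes p p' :: real
  assumes "0 < p'" "p' \<le> p" "p \<le> 1 / 2"
  shows "0 < p' / (1 - p')" "p' / (1 - p') \<le> p / (1 - p)" "p / (1 - p) \<le> 1" "p / (1 - p) \<le> 2 * p"
proof -
  show "p' / (1 - p') \<le> p / (1 - p)" using assms by (intro frac_le) auto
  have "p * (2 * p) \<le> p * 1" using assms by (intro mult_left_mono) auto
  then show "0 < p' / (1 - p')" "p / (1 - p) \<le> 1" "p / (1 - p) \<le> 2 * p"
    using assms by (auto simp: field_simps)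
qed

lemma information_near:
  fixes A :: real
  assumes P: "P \<in> community_assignments k \<nu> n" "\<And>S. S \<in> P \<Longrightarrow> \<bar>real (card S) - real n / real k\<bar> \<le> 1"
    and k: "1 \<le> k" and ab: "0 < b" "b < a" "a \<le> real n / 2" and A: "0 < A" "A \<le> 1 / 3" and i: "i \<in> {1..n}"
  shows "\<bar>random_edges.information (vertex_pairs n) (null_prob n P a b) i - null_information k n a b\<bar> \<le> 2"
proof -
  interpret random_edges "vertex_pairs n" "null_prob n P a b" A
    by (rule random_edges_null_prob[OF ab A])
  define va vb where "va = a / real n / (1 - a / real n)" and "vb = b / real n / (1 - b / real n)"
  have part: "partition_on {1..n} P" using P by (simp add: community_assignments_def)
  obtain Q where Q: "Q \<in> P" "i \<in> Q" using part i unfolding partition_on_def by blast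
  have QV: "Q \<subseteq> {1..n}" using part Q unfolding partition_on_def by blast
  have same: "(\<exists>S\<in>P. i \<in> S \<and> j \<in> S) \<longleftrightarrow> j \<in> Q" for j
    using part Q unfolding partition_on_def disjoint_def by blast
  have same': "(\<exists>S\<in>P. min i j \<in> S \<and> max i j \<in> S) \<longleftrightarrow> j \<in> Q" for j
    using same[of j] by (auto simp: min_def max_def)
  have "information i = (\<Sum>j\<in>{1..n} - {i}. if j \<in> Q then va else vb)"
    unfolding information_def sum_incidences_vertex_pairs[OF i]
    by (intro sum.cong refl) (simp add: null_prob_eq[OF ab] same' va_def vb_def)
  also have "\<dots> = real (card (Q - {i})) * va + real (card ({1..n} - Q)) * vb"
  proof -
    have "{j \<in> {1..n} - {i}. j \<in> Q} = Q - {i}" "{j \<in> {1..n} - {i}. j \<notin> Q} = {1..n} - Q"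
      using QV Q by auto
    then show ?thesis by (simp add: sum.If_cases Int_def)
  qed
  also have "real (card (Q - {i})) = real (card Q) - 1"
    using card.remove[of Q i] Q finite_subset[OF QV] by simp
  also have "real (card ({1..n} - Q)) = real n - real (card Q)"
    using QV card_mono[OF _ QV] by (simp add: card_Diff_subset finite_subset of_nat_diff)
  finally have info: "information i = (real (card Q) - 1) * va + (real n - real (card Q)) * vb" .
  have "information i - null_information k n a b = (real (card Q) - real n / real k) * (va - vb) - va"
  proof -
    have "(real k - 1) * real n / real k = real n - real n / real k"
      using k by (simp add: field_simps)
    then have "null_information k n a b = real n / real k * va + (real n - real n / real k) * vb"
      unfolding null_information_def va_def vb_def by (rule arg_cong)
    moreover define h where "h = real n / real k"
    ultimately show ?thesis using info unfolding h_def[symmetric] by (simp add: algebra_simps)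
  qed
  moreover have v: "0 < vb" "vb \<le> va" "va \<le> 1"
    using odds_bounds[of "b / real n" "a / real n"] ab by (auto simp: va_def vb_def divide_le_eq divide_right_mono)
  moreover have "\<bar>(real (card Q) - real n / real k) * (va - vb)\<bar> \<le> 1"
    unfolding abs_mult using P(2)[OF Q(1)] v by (intro mult_le_one) auto
  ultimately show ?thesis by linarith
qed

lemma internal_information_le:
  fixes A :: real
  assumes ab: "0 < b" "b < a" "a \<le> real n / 2" and A: "0 < A" "A \<le> 1 / 3"
    and W: "W \<subseteq> {1..n}" "card W \<le> 2 * s"
  shows "random_edges.internal_information (vertex_pairs n) (null_prob n P a b) W \<le> 8 * (real s)\<^sup>2 * (a / real n)"
proof -
  interpret random_edges "vertex_pairs n" "null_prob n P a b" A
    by (rule random_edges_null_prob[OF ab A])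
  let ?I = "{e \<in> vertex_pairs n. fst e \<in> W \<and> snd e \<in> W}"
  have finW: "finite W" using W finite_subset by auto
  have "internal_information W \<le> (\<Sum>e\<in>?I. 2 * (a / real n))"
    unfolding internal_information_def
  proof (rule sum_mono)
    fix e assume e: "e \<in> ?I"
    have "null_prob n P a b e \<le> a / real n"
      using ab by (cases e) (auto simp: null_prob_eq[OF ab] divide_right_mono)
    then show "null_prob n P a b e / (1 - null_prob n P a b e) \<le> 2 * (a / real n)"
      using odds_bounds(4)[of "null_prob n P a b e" "null_prob n P a b e"] prob_bounds[of e] e by force
  qed
  also have "\<dots> = real (card ?I) * (2 * (a / real n))" by simp
  also have "\<dots> \<le> (2 * real s)\<^sup>2 * (2 * (a / real n))"
  proof (rule mult_right_mono)
    have "card ?I \<le> card (W \<times> W)" using finW by (intro card_mono) auto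
    also have "\<dots> \<le> (2 * s) * (2 * s)" unfolding card_cartesian_product using W by (intro mult_mono) auto
    finally show "real (card ?I) \<le> (2 * real s)\<^sup>2"
      by (simp add: power2_eq_square flip: of_nat_mult)
  qed (use ab in auto)
  also have "\<dots> = 8 * (real s)\<^sup>2 * (a / real n)" by (simp add: power2_eq_square)
  finally show ?thesis .
qed

lemma finite_community_assignments: "finite (community_assignments k \<nu> n)"
proof (rule finite_subset)
  show "community_assignments k \<nu> n \<subseteq> Pow (Pow {1..n})"
    by (auto simp: community_assignments_def partition_on_def)
qed simp

section \<open>A risk bound for fixed sample size\<close>

text \<open>A maximum or supremum dominates every average, here one over a single assignment and all sets of
\<open>s\<close> vertices whose parameter is exactly \<open>1 + A\<close>.\<close>

lemma risk_ge_average: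
  assumes P: "P \<in> community_assignments k \<nu> n" and A: "0 < A" and s: "s \<le> n"
  shows "measure_pmf.prob (graph_law n P (\<lambda>_. 1) a b) {Y. T Y}
      + (\<Sum>S\<in>{S. S \<subseteq> {1..n} \<and> card S = s}.
          measure_pmf.prob (graph_law n P (\<lambda>i. if i \<in> S then 1 + A else 1) a b) {Y. \<not> T Y}) / real (n choose s)
    \<le> risk n T a b (alternatives n s A) (community_assignments k \<nu> n)"
proof -
  let ?C = "community_assignments k \<nu> n" and ?F = "{S. S \<subseteq> {1..n} \<and> card S = s}"
  let ?miss = "\<lambda>\<theta> P. measure_pmf.prob (graph_law n P \<theta> a b) {Y. \<not> T Y}"
  have fin: "finite ?C" by (rule finite_community_assignments)
  have bdd: "bdd_above ((\<lambda>\<theta>. MAX P\<in>?C. ?miss \<theta> P) ` alternatives n s A)"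
    using fin P by (intro bdd_aboveI2[of _ _ 1]) (subst Max_le_iff, auto)
  have miss: "?miss (\<lambda>i. if i \<in> S then 1 + A else 1) P \<le> (SUP \<theta>\<in>alternatives n s A. MAX P\<in>?C. ?miss \<theta> P)" if "S \<in> ?F" for S
  proof -
    have "{i \<in> {1..n}. (if i \<in> S then 1 + A else 1) \<noteq> 1} = S" using A that by auto
    then have "(\<lambda>i. if i \<in> S then 1 + A else 1) \<in> alternatives n s A"
      using A that by (auto simp: alternatives_def)
    then have "(MAX P\<in>?C. ?miss (\<lambda>i. if i \<in> S then 1 + A else 1) P) \<le> (SUP \<theta>\<in>alternatives n s A. MAX P\<in>?C. ?miss \<theta> P)"
      using bdd by (rule cSUP_upper)
    moreover have "?miss (\<lambda>i. if i \<in> S then 1 + A else 1) P \<le> (MAX P\<in>?C. ?miss (\<lambda>i. if i \<in> S then 1 + A else 1) P)"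
      using fin P by (intro Max_ge) auto
    ultimately show ?thesis by linarith
  qed
  have "card ?F = n choose s" using n_subsets[of "{1..n}" s] by simp
  then have "(\<Sum>S\<in>?F. ?miss (\<lambda>i. if i \<in> S then 1 + A else 1) P) / real (n choose s) \<le> (SUP \<theta>\<in>alternatives n s A. MAX P\<in>?C. ?miss \<theta> P)"
    using sum_bounded_above[of ?F, OF miss] s by (simp add: pos_divide_le_eq mult.commute)
  moreover have "measure_pmf.prob (graph_law n P (\<lambda>_. 1) a b) {Y. T Y} \<le> (MAX P\<in>?C. measure_pmf.prob (graph_law n P (\<lambda>_. 1) a b) {Y. T Y})"
    using fin P by (intro Max_ge) auto
  ultimately show ?thesis unfolding risk_def by linarith
qed

theorem risk_ge:
  assumes P: "P \<in> community_assignments k \<nu> n" "\<And>S. S \<in> P \<Longrightarrow> \<bar>real (card S) - real n / real k\<bar> \<le> 1"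
    and k: "1 \<le> k" and ab: "0 < b" "b < a" "a \<le> real n / 2" and A: "0 < A" "A \<le> 1 / 3" and s: "s \<le> n"
    and \<mu>: "0 \<le> \<mu>" "2 * \<mu> * A \<le> 1" and \<kappa>: "0 \<le> \<kappa>" "2 * \<kappa> * A \<le> 1"
    and q1: "\<And>x. \<bar>x\<bar> \<le> A \<Longrightarrow> (1 + x) * exp (\<mu> * x) \<le> 1 + (1 + \<mu>) * x + q1 * x\<^sup>2"
    and q2: "\<And>x. \<bar>x\<bar> \<le> A \<Longrightarrow> (1 + x)\<^sup>2 * exp (- \<kappa> * x) \<le> 1 + (2 - \<kappa>) * x + q2 * x\<^sup>2"
    and K: "crude_constant \<mu> q1 \<le> K" "crude_constant (- \<kappa>) q2 \<le> K"
  defines "x0 \<equiv> 8 * K * A\<^sup>2 * (real s)\<^sup>2 * (a / real n)"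
    and "x1 \<equiv> q1 * A\<^sup>2 * null_information k n a b + 2 * \<bar>q1\<bar> * A\<^sup>2"
    and "x2 \<equiv> q2 * A\<^sup>2 * null_information k n a b + 2 * \<bar>q2\<bar> * A\<^sup>2"
  shows "1 - sqrt (2 * (real s * exp (x1 + x0 - \<mu> * c))
      + (exp (x0 + exp (x2 + \<kappa> * c) * (real s)\<^sup>2 / real n) - 1))
    \<le> risk n T a b (alternatives n s A) (community_assignments k \<nu> n)"
proof -
  interpret random_edges "vertex_pairs n" "null_prob n P a b" A
    by (rule random_edges_null_prob[OF ab A])
  have info: "q * A\<^sup>2 * information i \<le> q * A\<^sup>2 * null_information k n a b + 2 * \<bar>q\<bar> * A\<^sup>2" if "i \<in> {1..n}" for i q
  proof -
    have "\<bar>q * A\<^sup>2 * (information i - null_information k n a b)\<bar> \<le> \<bar>q\<bar> * A\<^sup>2 * 2"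
      unfolding abs_mult using information_near[OF P k ab A that] by (intro mult_mono) auto
    then show ?thesis by (simp add: algebra_simps abs_le_iff)
  qed
  have internal: "c * A\<^sup>2 * internal_information W \<le> x0" if "c \<le> K" "W \<subseteq> {1..n}" "card W \<le> 2 * s" "0 \<le> c" for c W
  proof -
    have "0 \<le> internal_information W"
      unfolding internal_information_def using prob_bounds by (intro sum_nonneg divide_nonneg_nonneg) force+
    then have "c * A\<^sup>2 * internal_information W \<le> K * A\<^sup>2 * (8 * (real s)\<^sup>2 * (a / real n))"
      using that internal_information_le[OF ab A, of W s P] by (intro mult_mono) auto
    then show ?thesis by (simp add: x0_def mult_ac)
  qed
  have crude: "0 \<le> crude_constant z q" for z q by (simp add: crude_constant_def)
  have "1 - sqrt (2 * (real s * exp (x1 + x0 - \<mu> * c))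
      + (exp (x0 + exp (x2 + \<kappa> * c) * (real s)\<^sup>2 / real (card {1..n})) - 1))
    \<le> measure_pmf.prob (law {}) {X. T (adjacency X)}
      + (\<Sum>S\<in>{S. S \<subseteq> {1..n} \<and> card S = s}. measure_pmf.prob (law S) (- {X. T (adjacency X)})) / real (card {1..n} choose s)"
    using s by (intro average_error_ge[where ?q1.0 = q1 and ?q2.0 = q2] \<mu> \<kappa> q1 q2) (auto simp: x1_def x2_def intro!: info internal K crude)
  also have "\<dots> = measure_pmf.prob (graph_law n P (\<lambda>_. 1) a b) {Y. T Y}
      + (\<Sum>S\<in>{S. S \<subseteq> {1..n} \<and> card S = s}.
          measure_pmf.prob (graph_law n P (\<lambda>i. if i \<in> S then 1 + A else 1) a b) {Y. \<not> T Y}) / real (n choose s)"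
    using graph_law_eq_map_law[OF ab A, of P "{}"]
    by (simp add: graph_law_eq_map_law[OF ab A] vimage_def Collect_neg_eq)
  also have "\<dots> \<le> risk n T a b (alternatives n s A) (community_assignments k \<nu> n)"
    by (rule risk_ge_average[OF P(1) A(1) s])
  finally show ?thesis by simp
qed

section \<open>Choice of the truncation\<close>

text \<open>Here \<open>n powr (2 * r)\<close> is the second moment of the likelihood ratio contributed by one common planted
vertex, \<open>t * ln n\<close> is the truncation level, and the two inequalities say that the first and second
moment errors are negative powers of \<open>n\<close>. For \<open>r < \<alpha> - 1 / 2\<close> the plain second moment is good enough
and \<open>t\<close> only has to be large. Otherwise \<open>r \<ge> 1 / 4\<close>, and with \<open>t = 2 * sqrt r\<close> the optimal parameters turn
both inequalities into \<open>1 - \<alpha> < (1 - sqrt r)\<^sup>2\<close>. This level is, to leading order, where the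
maximum of \<open>A * degree_score i\<close> over all \<open>n\<close> vertices lies under the null law.\<close>

lemma truncation_parameters:
  fixes r \<alpha> :: real
  assumes r: "0 < r" and \<alpha>: "1 / 2 < \<alpha>" "\<alpha> < 1"
    and less: "r < (if \<alpha> < 3 / 4 then \<alpha> - 1 / 2 else (1 - sqrt (1 - \<alpha>))\<^sup>2)"
  obtains \<mu> \<kappa> t where "0 \<le> \<mu>" "0 \<le> \<kappa>"
    "2 * r * (\<mu> + \<mu>\<^sup>2 / 2) - \<mu> * t + (1 - \<alpha>) < 0"
    "2 * r * (1 - 2 * \<kappa> + \<kappa>\<^sup>2 / 2) + \<kappa> * t + (1 - 2 * \<alpha>) < 0"
proof (cases "r < \<alpha> - 1 / 2")
  case True
  \<comment> \<open>With \<open>t = 2 * r * (1 + \<mu>)\<close> the first expression is \<open>(1 - \<alpha>) - r * \<mu>\<^sup>2\<close>; this \<open>\<mu>\<close> makes \<open>r * \<mu>\<^sup>2 > 2\<close>.\<close>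
  define \<mu> where "\<mu> = 1 + 1 / r"
  have "r * \<mu>\<^sup>2 = (r * \<mu>) * \<mu>" by (simp add: power2_eq_square)
  also have "r * \<mu> = r + 1" using r by (simp add: \<mu>_def distrib_left)
  also have "(r + 1) * \<mu> = r + 2 + 1 / r" using r by (simp add: \<mu>_def field_simps)
  finally have "r * \<mu>\<^sup>2 > 1 - \<alpha>" using r \<alpha> divide_pos_pos[of 1 r] by linarith
  moreover have "2 * r * (\<mu> + \<mu>\<^sup>2 / 2) - \<mu> * (2 * r + 2 * r * \<mu>) = - (r * \<mu>\<^sup>2)"
    by (simp add: power2_eq_square algebra_simps)
  ultimately have "2 * r * (\<mu> + \<mu>\<^sup>2 / 2) - \<mu> * (2 * r + 2 * r * \<mu>) + (1 - \<alpha>) < 0"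
    by linarith
  moreover have "0 \<le> \<mu>" using r by (simp add: \<mu>_def)
  ultimately show ?thesis using True by (intro that[of \<mu> 0 "2 * r + 2 * r * \<mu>"]) auto
next
  case False
  then have \<alpha>34: "\<alpha> \<ge> 3 / 4" using less by (auto split: if_splits)
  define R where "R = sqrt r"
  have R2: "r = R\<^sup>2" using r by (simp add: R_def)
  have R0: "0 < R" using r by (simp add: R_def)
  have "1 / 4 \<le> R\<^sup>2" using False \<alpha>34 unfolding R2 by linarith
  then have "(1 / 2)\<^sup>2 \<le> R\<^sup>2" by (simp add: power2_eq_square)
  then have R12: "1 / 2 \<le> R" using R0 by (rule power2_le_imp_le[OF _ less_imp_le])
  have sq: "0 \<le> sqrt (1 - \<alpha>)" "sqrt (1 - \<alpha>) < 1" using \<alpha> by auto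
  have "R\<^sup>2 < (1 - sqrt (1 - \<alpha>))\<^sup>2" using less \<alpha>34 unfolding R2 by simp
  then have "R < 1 - sqrt (1 - \<alpha>)" by (rule power2_less_imp_less) (use sq in simp)
  then have "sqrt (1 - \<alpha>) < 1 - R" by simp
  then have "(sqrt (1 - \<alpha>))\<^sup>2 < (1 - R)\<^sup>2" using sq by (intro power_strict_mono) auto
  then have gap: "1 - \<alpha> < (1 - R)\<^sup>2" using \<alpha> by simp
  \<comment> \<open>The minimisers of the two quadratics for \<open>t = 2 * R\<close>; here \<open>\<kappa> \<ge> 0\<close> needs \<open>R \<ge> 1 / 2\<close>.\<close>
  define \<mu> \<kappa> where "\<mu> = 1 / R - 1" and "\<kappa> = 2 - 1 / R"
  have R\<mu>: "R * \<mu> = 1 - R" and R\<kappa>: "R * \<kappa> = 2 * R - 1"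
    using R0 by (simp_all add: \<mu>_def \<kappa>_def right_diff_distrib)
  have "2 * r * (\<mu> + \<mu>\<^sup>2 / 2) - \<mu> * (2 * R) + (1 - \<alpha>)
      = 2 * R * (R * \<mu>) + (R * \<mu>)\<^sup>2 - 2 * (R * \<mu>) + (1 - \<alpha>)"
    unfolding R2 by (simp add: power2_eq_square algebra_simps)
  also have "\<dots> = (1 - \<alpha>) - (1 - R)\<^sup>2"
    unfolding R\<mu> by (simp add: power2_eq_square algebra_simps)
  finally have "2 * r * (\<mu> + \<mu>\<^sup>2 / 2) - \<mu> * (2 * R) + (1 - \<alpha>) < 0" using gap by simp
  moreover have "2 * r * (1 - 2 * \<kappa> + \<kappa>\<^sup>2 / 2) + \<kappa> * (2 * R) + (1 - 2 * \<alpha>)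
      = 2 * R\<^sup>2 - 4 * R * (R * \<kappa>) + (R * \<kappa>)\<^sup>2 + 2 * (R * \<kappa>) + (1 - 2 * \<alpha>)"
    unfolding R2 by (simp add: power2_eq_square algebra_simps)
  then have "2 * r * (1 - 2 * \<kappa> + \<kappa>\<^sup>2 / 2) + \<kappa> * (2 * R) + (1 - 2 * \<alpha>) = 2 * ((1 - \<alpha>) - (1 - R)\<^sup>2)"
    unfolding R\<kappa> by (simp add: power2_eq_square algebra_simps)
  then have "2 * r * (1 - 2 * \<kappa> + \<kappa>\<^sup>2 / 2) + \<kappa> * (2 * R) + (1 - 2 * \<alpha>) < 0" using gap by simp
  moreover have "R \<le> 1" using \<open>R < 1 - sqrt (1 - \<alpha>)\<close> sq(1) by linarith
  then have "0 \<le> \<mu>" "0 \<le> \<kappa>" using R0 R12 by (auto simp: \<mu>_def \<kappa>_def divide_le_eq)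
  ultimately show ?thesis by (intro that[of \<mu> \<kappa> "2 * R"])
qed

section \<open>Signal strength and information\<close>

lemma sigma_sq_ge:
  assumes k: "1 \<le> k" and ab: "0 < b" "b < a" "a \<le> real n / 2"
  shows "a / (2 * real k) \<le> sigma_sq k n a b"
proof -
  have n: "real n > 0" using ab by simp
  have "a / (2 * real k) = a / real k * (1 / 2)" by simp
  also have "\<dots> \<le> a / real k * (1 - a / real n)"
    using ab n by (intro mult_left_mono) (auto simp: field_simps)
  also have "\<dots> = real n / real k * (a / real n) * (1 - a / real n)" using n by simp
  also have "\<dots> \<le> sigma_sq k n a b"
  proof -
    have "0 \<le> 1 - b / real n" using ab n by (simp add: field_simps)
    then have "0 \<le> (real k - 1) * real n / real k * (b / real n) * (1 - b / real n)"
      using k ab by (intro mult_nonneg_nonneg divide_nonneg_nonneg) auto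
    then show ?thesis by (simp add: sigma_sq_def)
  qed
  finally show ?thesis .
qed

lemma null_information_between:
  assumes k: "1 \<le> k" and ab: "0 < b" "b < a" "a \<le> real n / 2"
  shows "sigma_sq k n a b \<le> null_information k n a b"
    "null_information k n a b \<le> sigma_sq k n a b / (1 - a / real n)\<^sup>2"
proof -
  have n: "real n > 0" using ab by simp
  define p p' where "p = a / real n" and "p' = b / real n"
  have p: "0 < p'" "p' \<le> p" "p \<le> 1 / 2"
    using ab n by (auto simp: p_def p'_def field_simps)
  define x y where "x = real n / real k" and "y = (real k - 1) * real n / real k"
  have xy: "0 \<le> x" "0 \<le> y" using k by (auto simp: x_def y_def)
  have N: "null_information k n a b = x * (p / (1 - p)) + y * (p' / (1 - p'))"
    by (simp only: null_information_def x_def y_def p_def p'_def)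
  have S: "sigma_sq k n a b = x * (p * (1 - p)) + y * (p' * (1 - p'))"
    by (simp only: sigma_sq_def x_def y_def p_def p'_def mult.assoc)
  have lower: "z * (1 - z) \<le> z / (1 - z)" if "0 \<le> z" "z \<le> 1 / 2" for z :: real
  proof -
    have "z * (1 - z) * (1 - z) \<le> z * 1 * 1" using that by (intro mult_mono) auto
    then show ?thesis using that by (simp add: pos_le_divide_eq)
  qed
  show "sigma_sq k n a b \<le> null_information k n a b"
    unfolding N S using p by (intro add_mono mult_left_mono lower xy) auto
  have upper: "z / (1 - z) \<le> z * (1 - z) / (1 - p)\<^sup>2" if "0 \<le> z" "z \<le> p" for z
  proof -
    have "z / (1 - z) = z * (1 - z) / (1 - z)\<^sup>2" using that p by (simp add: power2_eq_square)
    also have "\<dots> \<le> z * (1 - z) / (1 - p)\<^sup>2"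
      using that p by (intro divide_left_mono power_mono mult_nonneg_nonneg mult_pos_pos) auto
    finally show ?thesis .
  qed
  have "null_information k n a b \<le> x * (p * (1 - p) / (1 - p)\<^sup>2) + y * (p' * (1 - p') / (1 - p)\<^sup>2)"
    unfolding N using p by (intro add_mono mult_left_mono upper xy) auto
  also have "\<dots> = sigma_sq k n a b / (1 - a / real n)\<^sup>2"
    unfolding S p_def[symmetric] by (simp add: add_divide_distrib)
  finally show "null_information k n a b \<le> sigma_sq k n a b / (1 - a / real n)\<^sup>2" .
qed

text \<open>At \<open>\<tau>\<^sub>a = \<tau>\<^sub>b = 0\<close> both quantities divided by \<open>n\<close> vanish in the limit, so the ratio is squeezed between
1 and \<open>1 / (1 - a / n)\<^sup>2\<close>; otherwise the limits may be taken in numerator and denominator.\<close>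

lemma information_ratio_tendsto:
  fixes a b :: "nat \<Rightarrow> real"
  assumes k: "1 \<le> k" and ab: "\<forall>\<^sub>F n in sequentially. 0 < b n \<and> b n < a n \<and> a n \<le> real n / 2"
    and \<tau>: "(\<lambda>n. a n / real n) \<longlonglongrightarrow> \<tau>\<^sub>a" "(\<lambda>n. b n / real n) \<longlonglongrightarrow> \<tau>\<^sub>b"
    and pos: "0 < variance_ratio k \<tau>\<^sub>a \<tau>\<^sub>b"
  shows "(\<lambda>n. null_information k n (a n) (b n) / sigma_sq k n (a n) (b n)) \<longlonglongrightarrow> 1 / variance_ratio k \<tau>\<^sub>a \<tau>\<^sub>b"
proof (cases "\<tau>\<^sub>a = 0 \<and> \<tau>\<^sub>b = 0")
  case True
  have lim: "(\<lambda>n. 1 / (1 - a n / real n)\<^sup>2) \<longlonglongrightarrow> 1 / (1 - 0)\<^sup>2"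
    using \<tau>(1) True by (intro tendsto_divide tendsto_const tendsto_power tendsto_diff) auto
  have "\<forall>\<^sub>F n in sequentially. 1 \<le> null_information k n (a n) (b n) / sigma_sq k n (a n) (b n)
      \<and> null_information k n (a n) (b n) / sigma_sq k n (a n) (b n) \<le> 1 / (1 - a n / real n)\<^sup>2"
    using ab
  proof eventually_elim
    case (elim n)
    then have "0 < a n / (2 * real k)" using k by simp
    then have "0 < sigma_sq k n (a n) (b n)" using sigma_sq_ge[OF k, of "b n" "a n" n] elim by simp
    then show ?case using null_information_between[OF k, of "b n" "a n" n] elim
      by (simp add: pos_le_divide_eq pos_divide_le_eq)
  qed
  then have ev: "\<forall>\<^sub>F n in sequentially. 1 \<le> null_information k n (a n) (b n) / sigma_sq k n (a n) (b n)"
      "\<forall>\<^sub>F n in sequentially. null_information k n (a n) (b n) / sigma_sq k n (a n) (b n) \<le> 1 / (1 - a n / real n)\<^sup>2"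
    by (auto elim: eventually_mono)
  have "(\<lambda>n. null_information k n (a n) (b n) / sigma_sq k n (a n) (b n)) \<longlonglongrightarrow> 1"
    by (rule real_tendsto_sandwich[OF ev tendsto_const]) (use lim in simp)
  then show ?thesis using True by (simp add: variance_ratio_def)
next
  case False
  let ?N = "1 / real k * \<tau>\<^sub>a * (1 - \<tau>\<^sub>a) + (real k - 1) / real k * \<tau>\<^sub>b * (1 - \<tau>\<^sub>b)"
  let ?D = "1 / real k * (\<tau>\<^sub>a / (1 - \<tau>\<^sub>a)) + (real k - 1) / real k * (\<tau>\<^sub>b / (1 - \<tau>\<^sub>b))"
  have vr: "variance_ratio k \<tau>\<^sub>a \<tau>\<^sub>b = ?N / ?D" using False by (auto simp: variance_ratio_def)
  then have ne: "?N \<noteq> 0" using pos by auto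
  have "\<forall>\<^sub>F n in sequentially. a n / real n \<le> 1 / 2"
    using ab by eventually_elim (auto simp: divide_le_eq)
  moreover have "\<forall>\<^sub>F n in sequentially. b n / real n \<le> 1 / 2"
    using ab by eventually_elim (auto simp: divide_le_eq)
  ultimately have le: "\<tau>\<^sub>a \<le> 1 / 2" "\<tau>\<^sub>b \<le> 1 / 2"
    using tendsto_upperbound[OF \<tau>(1), of "1 / 2"] tendsto_upperbound[OF \<tau>(2), of "1 / 2"] by simp_all
  have "(\<lambda>n. (1 / real k * ((a n / real n) / (1 - a n / real n)) + (real k - 1) / real k * ((b n / real n) / (1 - b n / real n)))
      / (1 / real k * (a n / real n) * (1 - a n / real n) + (real k - 1) / real k * (b n / real n) * (1 - b n / real n)))
    \<longlonglongrightarrow> ?D / ?N"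
    using \<tau> le ne by (intro tendsto_divide tendsto_add tendsto_mult tendsto_diff tendsto_const) auto
  moreover have "\<forall>\<^sub>F n in sequentially. null_information k n (a n) (b n) / sigma_sq k n (a n) (b n)
    = (1 / real k * ((a n / real n) / (1 - a n / real n)) + (real k - 1) / real k * ((b n / real n) / (1 - b n / real n)))
      / (1 / real k * (a n / real n) * (1 - a n / real n) + (real k - 1) / real k * (b n / real n) * (1 - b n / real n))"
    using eventually_gt_at_top[of 0]
  proof eventually_elim
    case (elim n)
    define p p' where "p = a n / real n" and "p' = b n / real n"
    have factor: "real n / real k * u + (real k - 1) * real n / real k * u' = real n * (1 / real k * u + (real k - 1) / real k * u')" for u u'
      by (simp add: distrib_left)
    have "null_information k n (a n) (b n) = real n * (1 / real k * (p / (1 - p)) + (real k - 1) / real k * (p' / (1 - p')))"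
      unfolding null_information_def p_def[symmetric] p'_def[symmetric] by (rule factor)
    moreover have "sigma_sq k n (a n) (b n) = real n * (1 / real k * p * (1 - p) + (real k - 1) / real k * p' * (1 - p'))"
      unfolding sigma_sq_def p_def[symmetric] p'_def[symmetric] mult.assoc[of _ p] mult.assoc[of _ p'] by (rule factor)
    ultimately show ?case using elim by (simp add: p_def[symmetric] p'_def[symmetric])
  qed
  ultimately show ?thesis
    unfolding vr by (subst tendsto_cong) auto
qed

section \<open>The detection boundary\<close>

lemma exp_negative_drift_tendsto_0:
  fixes u v :: "nat \<Rightarrow> real"
  assumes "u \<longlonglongrightarrow> c" "c < 0" "v \<longlonglongrightarrow> d"
  shows "(\<lambda>n. exp (u n * ln (real n) + v n)) \<longlonglongrightarrow> 0"
proof -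
  have "filterlim (\<lambda>n. ln (real n)) at_top sequentially"
    by (rule filterlim_compose[OF ln_at_top filterlim_real_sequentially])
  then have "filterlim (\<lambda>n. - u n * ln (real n)) at_top sequentially"
    using assms by (intro filterlim_tendsto_pos_mult_at_top[OF tendsto_minus[OF assms(1)]]) auto
  then have "filterlim (\<lambda>n. - v n + - u n * ln (real n)) at_top sequentially"
    by (rule filterlim_tendsto_add_at_top[OF tendsto_minus[OF assms(3)]])
  then have "filterlim (\<lambda>n. u n * ln (real n) + v n) at_bot sequentially"
    by (simp add: filterlim_uminus_at_bot algebra_simps)
  then show ?thesis by (rule filterlim_compose[OF exp_at_bot])
qed

theorem theorem3p2:
  fixes k :: nat and \<nu> \<alpha> C \<tau>\<^sub>a \<tau>\<^sub>b :: real
    and a b A :: "nat \<Rightarrow> real" and s :: "nat \<Rightarrow> nat"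
  assumes "1 \<le> k" and "1 \<le> \<nu>"
    and "\<forall>\<^sub>F n in sequentially. 0 < b n \<and> b n < a n \<and> a n \<le> real n / 2"
    and "0 < liminf (\<lambda>n. ereal (b n / a n))"
    and "limsup (\<lambda>n. ereal (b n / a n)) < 1"
    and "(\<lambda>n. a n / real n) \<longlonglongrightarrow> \<tau>\<^sub>a"
    and "(\<lambda>n. b n / real n) \<longlonglongrightarrow> \<tau>\<^sub>b"
    and "(\<lambda>n. ln (real n) / b n) \<longlonglongrightarrow> 0"
    and "1 / 2 < \<alpha>" and "\<alpha> < 1"
    and "\<forall>n. s n = nat \<lfloor>real n powr (1 - \<alpha>)\<rfloor> \<or> s n = nat \<lceil>real n powr (1 - \<alpha>)\<rceil>"
    and "\<forall>n. A n = sqrt (C * ln (real n) / sigma_sq k n (a n) (b n))"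
    and "0 < C" and "C < C_sparse k \<tau>\<^sub>a \<tau>\<^sub>b \<alpha>"
  shows "\<forall>T. asymptotically_powerless k \<nu> a b s A T"
proof
  fix T :: "nat \<Rightarrow> (nat \<Rightarrow> nat \<Rightarrow> nat) \<Rightarrow> bool"
  note k = assms(1) and \<nu> = assms(2) and ab = assms(3) and \<tau> = assms(6,7) and ln_small = assms(8)
    and \<alpha> = assms(9,10) and C = assms(13)
  define \<rho> where "\<rho> = (if \<alpha> < 3 / 4 then \<alpha> - 1 / 2 else (1 - sqrt (1 - \<alpha>))\<^sup>2)"
  define vr where "vr = variance_ratio k \<tau>\<^sub>a \<tau>\<^sub>b"
  have "sqrt (1 - \<alpha>) < 1" using \<alpha> by simp
  then have \<rho>: "0 < \<rho>" using \<alpha> by (simp add: \<rho>_def)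
  have less: "C < 2 * vr * \<rho>"
    using assms(14) by (auto simp: C_sparse_def vr_def \<rho>_def split: if_splits)
  then have "0 < (2 * vr) * \<rho>" using C by linarith
  then have vr: "0 < vr" using \<rho> by (simp add: zero_less_mult_iff)
  \<comment> \<open>Chosen so that \<open>A\<^sup>2\<close> times the information of a vertex is asymptotically \<open>2 * r * ln n\<close>.\<close>
  define r where "r = C / (2 * vr)"
  have r: "0 < r" "r < \<rho>" using C vr less by (auto simp: r_def pos_divide_less_eq mult_ac)
  obtain \<mu> \<kappa> t where \<mu>\<kappa>: "0 \<le> \<mu>" "0 \<le> \<kappa>"
    and first: "2 * r * (\<mu> + \<mu>\<^sup>2 / 2) - \<mu> * t + (1 - \<alpha>) < 0"
    and second: "2 * r * (1 - 2 * \<kappa> + \<kappa>\<^sup>2 / 2) + \<kappa> * t + (1 - 2 * \<alpha>) < 0"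
    using truncation_parameters[OF r(1) \<alpha> r(2)[unfolded \<rho>_def]] by blast
  \<comment> \<open>Room for replacing the exact Taylor coefficients by slightly larger ones.\<close>
  have slack: "\<exists>q'>q. 2 * r * q' + d < 0" if "2 * r * q + d < 0" for q d
  proof -
    define q' where "q' = q - (2 * r * q + d) / (4 * r)"
    have "2 * r * q' = 2 * r * q - (2 * r * q + d) / 2"
      using r by (simp add: q'_def right_diff_distrib)
    then have "2 * r * q' + d < 0" using that by argo
    moreover have "(2 * r * q + d) / (4 * r) < 0" using that r by (intro divide_neg_pos) auto
    then have "q < q'" by (simp add: q'_def)
    ultimately show ?thesis by blast
  qed
  obtain q1 where q1: "\<mu> + \<mu>\<^sup>2 / 2 < q1" "2 * r * q1 + (- \<mu> * t + (1 - \<alpha>)) < 0"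
    using slack[of "\<mu> + \<mu>\<^sup>2 / 2" "- \<mu> * t + (1 - \<alpha>)"] first by auto
  obtain q2 where q2: "1 - 2 * \<kappa> + \<kappa>\<^sup>2 / 2 < q2" "2 * r * q2 + (\<kappa> * t + (1 - 2 * \<alpha>)) < 0"
    using slack[of "1 - 2 * \<kappa> + \<kappa>\<^sup>2 / 2" "\<kappa> * t + (1 - 2 * \<alpha>)"] second by auto
  obtain d1 where d1: "d1 > 0" "\<And>x. \<bar>x\<bar> \<le> d1 \<Longrightarrow> (1 + x) * exp (\<mu> * x) \<le> 1 + (1 + \<mu>) * x + q1 * x\<^sup>2"
    using tilted_factor_le_quadratic[of 0 \<mu> q1] q1 by auto
  obtain d2 where d2: "d2 > 0" "\<And>x. \<bar>x\<bar> \<le> d2 \<Longrightarrow> (1 + x)\<^sup>2 * exp (- \<kappa> * x) \<le> 1 + (2 - \<kappa>) * x + q2 * x\<^sup>2"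
    using tilted_factor_le_quadratic[of 1 "- \<kappa>" q2] q2 by (auto simp: power2_eq_square)
  define K where "K = max (crude_constant \<mu> q1) (crude_constant (- \<kappa>) q2)"
  have K: "0 \<le> K" by (simp add: K_def crude_constant_def le_max_iff_disj)

  let ?\<sigma> = "\<lambda>n. sigma_sq k n (a n) (b n)" and ?I = "\<lambda>n. null_information k n (a n) (b n)"
  have A: "A n = sqrt (C * ln (real n) / ?\<sigma> n)" for n using assms(12) by simp
  have evA: "\<forall>\<^sub>F n in sequentially. 0 < ?\<sigma> n \<and> 0 < A n \<and> (A n)\<^sup>2 = C * ln (real n) / ?\<sigma> n
      \<and> (A n)\<^sup>2 * a n \<le> 2 * real k * C * ln (real n) \<and> (A n)\<^sup>2 \<le> 2 * real k * C * (ln (real n) / b n)"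
    using ab eventually_gt_at_top[of 1]
  proof eventually_elim
    case (elim n)
    have L: "0 < ln (real n)" using elim by simp
    have \<sigma>: "a n / (2 * real k) \<le> ?\<sigma> n" using sigma_sq_ge[OF k, of "b n" "a n" n] elim by simp
    have an: "0 < a n / (2 * real k)" using elim k by simp
    then have \<sigma>0: "0 < ?\<sigma> n" using \<sigma> by linarith
    have pos: "0 < C * ln (real n) / ?\<sigma> n" using C L \<sigma>0 by simp
    then have A2: "(A n)\<^sup>2 = C * ln (real n) / ?\<sigma> n" by (simp add: A)
    also have "\<dots> \<le> C * ln (real n) / (a n / (2 * real k))"
      using C L \<sigma> \<sigma>0 an by (intro divide_left_mono mult_pos_pos) auto
    finally have A2a: "(A n)\<^sup>2 \<le> 2 * real k * C * ln (real n) / a n" by (simp add: mult_ac)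
    have "2 * real k * C * ln (real n) / a n \<le> 2 * real k * C * ln (real n) / b n"
      using elim C L by (intro divide_left_mono mult_pos_pos) auto
    then have "(A n)\<^sup>2 \<le> 2 * real k * C * (ln (real n) / b n)" using A2a by simp
    moreover have "(A n)\<^sup>2 * a n \<le> 2 * real k * C * ln (real n)"
      using A2a elim by (simp add: pos_le_divide_eq)
    moreover have "0 < A n" unfolding A using pos by simp
    ultimately show ?case using \<sigma>0 A2 by blast
  qed
  have A2_lim: "(\<lambda>n. (A n)\<^sup>2) \<longlonglongrightarrow> 0"
  proof (rule real_tendsto_sandwich[OF _ _ tendsto_const])
    show "\<forall>\<^sub>F n in sequentially. (A n)\<^sup>2 \<le> 2 * real k * C * (ln (real n) / b n)"
      using evA by eventually_elim blast
    show "(\<lambda>n. 2 * real k * C * (ln (real n) / b n)) \<longlonglongrightarrow> 0"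
      using tendsto_mult_left[OF ln_small, of "2 * real k * C"] by simp
  qed auto
  have "(\<lambda>n. sqrt ((A n)\<^sup>2)) \<longlonglongrightarrow> sqrt 0" by (intro tendsto_intros A2_lim)
  then have "(\<lambda>n. \<bar>A n\<bar>) \<longlonglongrightarrow> 0" by simp
  then have A_lim: "A \<longlonglongrightarrow> 0" by (rule tendsto_rabs_zero_cancel)
  have small: "\<forall>\<^sub>F n in sequentially. A n < d" if "0 < d" for d
    using order_tendstoD(2)[OF A_lim that] .

  \<comment> \<open>\<open>w n * ln n\<close> is \<open>A\<^sup>2\<close> times the balanced information.\<close>
  define w where "w n = C * (?I n / ?\<sigma> n)" for n
  have "w \<longlonglongrightarrow> C * (1 / vr)"
    unfolding w_def vr_def
    by (intro tendsto_mult_left information_ratio_tendsto[OF k ab \<tau>]) (use vr vr_def in simp)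
  then have w_lim: "w \<longlonglongrightarrow> 2 * r" by (simp add: r_def)
  have evw: "\<forall>\<^sub>F n in sequentially. (A n)\<^sup>2 * ?I n = w n * ln (real n)"
    using evA by eventually_elim (simp add: w_def)

  have s_le: "\<forall>\<^sub>F n in sequentially. real (s n) \<le> 2 * real n powr (1 - \<alpha>)"
    using eventually_ge_at_top[of 1]
  proof eventually_elim
    case (elim n)
    have ge: "1 \<le> real n powr (1 - \<alpha>)" using elim \<alpha> by (intro ge_one_powr_ge_zero) auto
    have "real (nat \<lfloor>real n powr (1 - \<alpha>)\<rfloor>) \<le> real n powr (1 - \<alpha>) + 1"
      "real (nat \<lceil>real n powr (1 - \<alpha>)\<rceil>) \<le> real n powr (1 - \<alpha>) + 1"
      using ge of_int_floor_le[of "real n powr (1 - \<alpha>)"] ceiling_correct[of "real n powr (1 - \<alpha>)"]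
      by (simp_all add: of_nat_nat) linarith
    then have "real (s n) \<le> real n powr (1 - \<alpha>) + 1"
      using assms(11)[rule_format, of n] by auto
    then show ?case using ge by linarith
  qed
  have s_n: "\<forall>\<^sub>F n in sequentially. s n \<le> n"
  proof -
    have "\<forall>\<^sub>F n in sequentially. 2 * real n powr (1 - \<alpha>) \<le> real n"
      using \<alpha> by real_asymp
    with s_le show ?thesis by eventually_elim linarith
  qed

  \<comment> \<open>Edges inside planted sets: \<open>A\<^sup>2 * a\<close> is \<open>O(ln n)\<close> and \<open>s\<^sup>2 * ln n / n\<close> tends to 0 because \<open>\<alpha> > 1 / 2\<close>.\<close>
  define x0 where "x0 n = 8 * K * (A n)\<^sup>2 * (real (s n))\<^sup>2 * (a n / real n)" for n
  have x0_lim: "x0 \<longlonglongrightarrow> 0"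
  proof (rule real_tendsto_sandwich[OF _ _ tendsto_const])
    show "\<forall>\<^sub>F n in sequentially. 0 \<le> x0 n"
      using ab by eventually_elim (use K in \<open>simp add: x0_def\<close>)
    show "\<forall>\<^sub>F n in sequentially. x0 n \<le> 64 * K * real k * C * (ln (real n) * (real n powr (1 - \<alpha>))\<^sup>2 / real n)"
      using evA s_le ab eventually_gt_at_top[of 1]
    proof eventually_elim
      case (elim n)
      have "(A n)\<^sup>2 * a n * (real (s n))\<^sup>2 \<le> (2 * real k * C * ln (real n)) * (2 * real n powr (1 - \<alpha>))\<^sup>2"
      proof (rule mult_mono)
        show "(real (s n))\<^sup>2 \<le> (2 * real n powr (1 - \<alpha>))\<^sup>2" using elim by (intro power_mono) auto
        show "(A n)\<^sup>2 * a n \<le> 2 * real k * C * ln (real n)" using elim by blast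
      qed (use elim C in auto)
      then have prod_le: "8 * K / real n * ((A n)\<^sup>2 * a n * (real (s n))\<^sup>2)
          \<le> 8 * K / real n * ((2 * real k * C * ln (real n)) * (2 * real n powr (1 - \<alpha>))\<^sup>2)"
        by (rule mult_left_mono) (use K in simp)
      have "x0 n = 8 * K / real n * (((A n)\<^sup>2 * a n) * (real (s n))\<^sup>2)"
        by (simp add: x0_def)
      also have "\<dots> \<le> 8 * K / real n * ((2 * real k * C * ln (real n)) * (2 * real n powr (1 - \<alpha>))\<^sup>2)"
        by (rule prod_le)
      also have "\<dots> = 64 * K * real k * C * (ln (real n) * (real n powr (1 - \<alpha>))\<^sup>2 / real n)"
        by (simp add: power_mult_distrib)
      finally show ?case .
    qed
    have "(\<lambda>n::nat. ln (real n) * (real n powr (1 - \<alpha>))\<^sup>2 / real n) \<longlonglongrightarrow> 0"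
      using \<alpha> by real_asymp
    from tendsto_mult_left[OF this, of "64 * K * real k * C"]
    show "(\<lambda>n. 64 * K * real k * C * (ln (real n) * (real n powr (1 - \<alpha>))\<^sup>2 / real n)) \<longlonglongrightarrow> 0" by simp
  qed

  define x1 where "x1 n = q1 * (A n)\<^sup>2 * ?I n + 2 * \<bar>q1\<bar> * (A n)\<^sup>2" for n
  define x2 where "x2 n = q2 * (A n)\<^sup>2 * ?I n + 2 * \<bar>q2\<bar> * (A n)\<^sup>2" for n
  \<comment> \<open>The truncation loss and the excess of the second moment, at truncation level \<open>t * ln n\<close>.\<close>
  define e1 where "e1 n = real (s n) * exp (x1 n + x0 n - \<mu> * (t * ln (real n)))" for n
  define e2 where "e2 n = exp (x2 n + \<kappa> * (t * ln (real n))) * (real (s n))\<^sup>2 / real n" for n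
  have e1_lim: "e1 \<longlonglongrightarrow> 0"
  proof (rule real_tendsto_sandwich[OF _ _ tendsto_const])
    show "\<forall>\<^sub>F n in sequentially. 0 \<le> e1 n" by (simp add: e1_def)
    show "\<forall>\<^sub>F n in sequentially. e1 n
      \<le> 2 * exp ((w n * q1 + (- \<mu> * t + (1 - \<alpha>))) * ln (real n) + (2 * \<bar>q1\<bar> * (A n)\<^sup>2 + x0 n))"
      using s_le evw eventually_gt_at_top[of 0]
    proof eventually_elim
      case (elim n)
      have "e1 n \<le> (2 * real n powr (1 - \<alpha>)) * exp (x1 n + x0 n - \<mu> * (t * ln (real n)))"
        unfolding e1_def using elim by (intro mult_right_mono) auto
      also have "real n powr (1 - \<alpha>) = exp ((1 - \<alpha>) * ln (real n))"
        using elim by (simp add: powr_def)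
      also have "x1 n = q1 * (w n * ln (real n)) + 2 * \<bar>q1\<bar> * (A n)\<^sup>2"
        unfolding x1_def mult.assoc[of q1] elim(2) ..
      finally show ?case by (simp add: mult.assoc exp_add[symmetric] algebra_simps)
    qed
    have "(\<lambda>n. w n * q1 + (- \<mu> * t + (1 - \<alpha>))) \<longlonglongrightarrow> 2 * r * q1 + (- \<mu> * t + (1 - \<alpha>))"
      by (intro tendsto_add tendsto_mult_right w_lim tendsto_const)
    moreover have "(\<lambda>n. 2 * \<bar>q1\<bar> * (A n)\<^sup>2 + x0 n) \<longlonglongrightarrow> 2 * \<bar>q1\<bar> * 0 + 0"
      by (intro tendsto_add tendsto_mult_left A2_lim x0_lim)
    ultimately have "(\<lambda>n. exp ((w n * q1 + (- \<mu> * t + (1 - \<alpha>))) * ln (real n) + (2 * \<bar>q1\<bar> * (A n)\<^sup>2 + x0 n))) \<longlonglongrightarrow> 0"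
      using q1(2) by (intro exp_negative_drift_tendsto_0)
    from tendsto_mult_left[OF this, of 2]
    show "(\<lambda>n. 2 * exp ((w n * q1 + (- \<mu> * t + (1 - \<alpha>))) * ln (real n) + (2 * \<bar>q1\<bar> * (A n)\<^sup>2 + x0 n))) \<longlonglongrightarrow> 0"
      by simp
  qed
  have e2_lim: "e2 \<longlonglongrightarrow> 0"
  proof (rule real_tendsto_sandwich[OF _ _ tendsto_const])
    show "\<forall>\<^sub>F n in sequentially. 0 \<le> e2 n" by (simp add: e2_def)
    show "\<forall>\<^sub>F n in sequentially. e2 n
      \<le> 4 * exp ((w n * q2 + (\<kappa> * t + (1 - 2 * \<alpha>))) * ln (real n) + 2 * \<bar>q2\<bar> * (A n)\<^sup>2)"
      using s_le evw eventually_gt_at_top[of 0]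
    proof eventually_elim
      case (elim n)
      have "e2 n \<le> exp (x2 n + \<kappa> * (t * ln (real n))) * (2 * real n powr (1 - \<alpha>))\<^sup>2 / real n"
        unfolding e2_def using elim by (intro divide_right_mono mult_left_mono power_mono) auto
      also have "(2 * real n powr (1 - \<alpha>))\<^sup>2 = 4 * exp (2 * ((1 - \<alpha>) * ln (real n)))"
        using elim by (simp add: powr_def power_mult_distrib exp_double)
      also have "exp (x2 n + \<kappa> * (t * ln (real n))) * (4 * exp (2 * ((1 - \<alpha>) * ln (real n)))) / real n
        = 4 * (exp (x2 n + \<kappa> * (t * ln (real n))) * exp (2 * ((1 - \<alpha>) * ln (real n))) * exp (- ln (real n)))"
        using elim by (simp add: exp_minus divide_inverse)
      also have "x2 n = q2 * (w n * ln (real n)) + 2 * \<bar>q2\<bar> * (A n)\<^sup>2"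
        unfolding x2_def mult.assoc[of q2] elim(2) ..
      finally show ?case by (simp add: exp_add[symmetric] algebra_simps)
    qed
    have "(\<lambda>n. w n * q2 + (\<kappa> * t + (1 - 2 * \<alpha>))) \<longlonglongrightarrow> 2 * r * q2 + (\<kappa> * t + (1 - 2 * \<alpha>))"
      by (intro tendsto_add tendsto_mult_right w_lim tendsto_const)
    moreover have "(\<lambda>n. 2 * \<bar>q2\<bar> * (A n)\<^sup>2) \<longlonglongrightarrow> 2 * \<bar>q2\<bar> * 0"
      by (intro tendsto_mult_left A2_lim)
    ultimately have "(\<lambda>n. exp ((w n * q2 + (\<kappa> * t + (1 - 2 * \<alpha>))) * ln (real n) + 2 * \<bar>q2\<bar> * (A n)\<^sup>2)) \<longlonglongrightarrow> 0"
      using q2(2) by (intro exp_negative_drift_tendsto_0)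
    from tendsto_mult_left[OF this, of 4]
    show "(\<lambda>n. 4 * exp ((w n * q2 + (\<kappa> * t + (1 - 2 * \<alpha>))) * ln (real n) + 2 * \<bar>q2\<bar> * (A n)\<^sup>2)) \<longlonglongrightarrow> 0"
      by simp
  qed

  have err: "(\<lambda>n. 1 - sqrt (2 * e1 n + (exp (x0 n + e2 n) - 1))) \<longlonglongrightarrow> 1 - sqrt (2 * 0 + (exp (0 + 0) - 1))"
    by (intro tendsto_diff tendsto_const tendsto_real_sqrt tendsto_add tendsto_mult tendsto_exp e1_lim e2_lim x0_lim)
  let ?risk = "\<lambda>n. risk n (T n) (a n) (b n) (alternatives n (s n) (A n)) (community_assignments k \<nu> n)"
  have A_small: "\<forall>\<^sub>F n in sequentially. A n < 1 / 3 \<and> A n < d1 \<and> A n < d2 \<and> A n < 1 / (2 * (\<mu> + 1)) \<and> A n < 1 / (2 * (\<kappa> + 1))"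
    using d1(1) d2(1) \<mu>\<kappa> by (intro eventually_conj small) auto
  have bound: "\<forall>\<^sub>F n in sequentially. community_assignments k \<nu> n \<noteq> {} \<longrightarrow>
      1 - sqrt (2 * e1 n + (exp (x0 n + e2 n) - 1)) \<le> ?risk n"
    using ab evA s_n eventually_balanced_assignment[OF k \<nu>] A_small
  proof eventually_elim
    case (elim n)
    show ?case
    proof
      assume "community_assignments k \<nu> n \<noteq> {}"
      then obtain P where P: "P \<in> community_assignments k \<nu> n" "\<forall>S\<in>P. \<bar>real (card S) - real n / real k\<bar> \<le> 1"
        using elim(4) by blast
      have "2 * \<mu> * A n \<le> 1" "2 * \<kappa> * A n \<le> 1"
        using elim(2,5) \<mu>\<kappa> by (simp_all add: pos_less_divide_eq algebra_simps)
      then show "1 - sqrt (2 * e1 n + (exp (x0 n + e2 n) - 1)) \<le> ?risk n"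
        unfolding e1_def e2_def x0_def x1_def x2_def
        using elim \<mu>\<kappa> P k by (intro risk_ge[where P = P] d1(2) d2(2)) (auto simp: K_def)
    qed
  qed
  show "asymptotically_powerless k \<nu> a b s A T"
    unfolding asymptotically_powerless_def le_Liminf_iff eventually_inf_principal
  proof (intro allI impI)
    fix y :: ereal
    assume "y < 1"
    moreover have "(\<lambda>n. ereal (1 - sqrt (2 * e1 n + (exp (x0 n + e2 n) - 1)))) \<longlonglongrightarrow> 1"
      using tendsto_ereal[OF err] by (simp add: one_ereal_def)
    ultimately have "\<forall>\<^sub>F n in sequentially. y < ereal (1 - sqrt (2 * e1 n + (exp (x0 n + e2 n) - 1)))"
      by (rule order_tendstoD(1)[rotated])
    with bound show "\<forall>\<^sub>F n in sequentially. n \<in> {n. community_assignments k \<nu> n \<noteq> {}} \<longrightarrow> y < ereal (?risk n)"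
      by eventually_elim (auto intro: less_le_trans)
  qed
qed

end
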